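(* For $n\ge1$ let $P_{n}^{(\mathrm{pk},\mathrm{ipk})}(s,t)=\sum_{\pi\in\mathfrak{S}_{n}}s^{\mathrm{pk}(\pi)+1}t^{\mathrm{ipk}(\pi)+1}$. Then: (a) As formal power series, \[ \frac{1}{(1-s)(1-t)}+\frac{1}{4}\sum_{n=1}^{\infty}\left(\frac{(1+s)(1+t)}{(1-s)(1-t)}\right)^{n+1}P_{n}^{(\mathrm{pk},\mathrm{ipk})}\left(\frac{4s}{(1+s)^{2}},\frac{4t}{(1+t)^{2}}\right)x^{n} =\sum_{i,j=0}^{\infty}\left(\frac{1+x}{1-x}\right)^{2ij}s^{i}t^{j}. \] (b) For all $n\geq1$, \[ \left(\frac{(1+s)(1+t)}{(1-s)(1-t)}\right)^{n+1}P_{n}^{(\mathrm{pk},\mathrm{ipk})}\left(\frac{4s}{(1+s)^{2}},\frac{4t}{(1+t)^{2}}\right) =4\sum_{i,j=0}^{\infty}\sum_{k=0}^{n}\binom{2ij}{k}\binom{2ij+n-k-1}{n-k}s^{i}t^{j}. \] (c) For all $n\geq1$, \[ \left(\frac{(1+s)(1+t)}{(1-s)(1-t)}\right)^{n+1}P_{n}^{(\mathrm{pk},\mathrm{ipk})}\left(\frac{4s}{(1+s)^{2}},\frac{4t}{(1+t)^{2}}\right) =\frac{1}{n!}\sum_{k=0}^n 4^{k+1}d(n,k)\frac{A_{k}(s)A_{k}(t)}{(1-s)^{k+1}(1-t)^{k+1}}. \]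
   Context: $\mathfrak{S}_n$ is the symmetric group on $[n]$. For $\pi\in\mathfrak{S}_n$, $i\in[n-1]$ is a descent if $\pi(i)>\pi(i+1)$ and $\mathrm{des}(\pi)$ is the number of descents; $i$ with $2\le i\le n-1$ is a peak if $\pi(i-1)<\pi(i)>\pi(i+1)$ and $\mathrm{pk}(\pi)$ is the number of peaks; $\mathrm{ipk}(\pi)=\mathrm{pk}(\pi^{-1})$. The Eulerian polynomials are $A_n(t)=\sum_{\pi\in\mathfrak{S}_n}t^{\mathrm{des}(\pi)+1}$ for $n\ge1$ and $A_0(t)=1$. $d(n,k)$ denotes the number of permutations in $\mathfrak{S}_n$ with exactly $k$ cycles, all of odd length (with $d(0,0)=1$). *)

theory Defs
  imports
    "HOL-Computational_Algebra.Formal_Power_Series"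
    "HOL-Combinatorics.Permutations"
    "HOL-Combinatorics.Orbits"
begin

text \<open>The symmetric group on \<open>[n]\<close> is \<open>{p. p permutes {1..n}}\<close>; outside \<open>{1..n}\<close>
  such a \<open>p\<close> is the identity.\<close>

definition des :: "nat \<Rightarrow> (nat \<Rightarrow> nat) \<Rightarrow> nat" where
  "des n p = card {i \<in> {1..n - 1}. p i > p (i + 1)}"

definition pk :: "nat \<Rightarrow> (nat \<Rightarrow> nat) \<Rightarrow> nat" where
  "pk n p = card {i \<in> {2..n - 1}. p (i - 1) < p i \<and> p i > p (i + 1)}"

definition ipk :: "nat \<Rightarrow> (nat \<Rightarrow> nat) \<Rightarrow> nat" where
  "ipk n p = pk n (inv p)"

text \<open>The polynomials are given by their values at elements of an arbitrary commutative
  semiring, so that they can be evaluated at formal power series.\<close>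

definition P_pk_ipk :: "nat \<Rightarrow> 'a::comm_semiring_1 \<Rightarrow> 'a \<Rightarrow> 'a" where
  "P_pk_ipk n s t = (\<Sum>p | p permutes {1..n}. s ^ (pk n p + 1) * t ^ (ipk n p + 1))"

definition eulerian :: "nat \<Rightarrow> 'a::comm_semiring_1 \<Rightarrow> 'a" where
  "eulerian n t = (if n = 0 then 1 else (\<Sum>p | p permutes {1..n}. t ^ (des n p + 1)))"

text \<open>Cycles are represented by their supports; a fixed point \<open>x\<close> contributes the cycle \<open>{x}\<close>.\<close>

definition perm_cycles :: "nat \<Rightarrow> (nat \<Rightarrow> nat) \<Rightarrow> nat set set" where
  "perm_cycles n p = orbit p ` {1..n}"

definition odd_cycle_count :: "nat \<Rightarrow> nat \<Rightarrow> nat" where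
  "odd_cycle_count n k = card {p. p permutes {1..n} \<and> card (perm_cycles n p) = k \<and>
     (\<forall>c \<in> perm_cycles n p. odd (card c))}"

text \<open>The ring of formal power series in \<open>s\<close> and \<open>t\<close> is \<open>rat fps fps\<close>, where \<open>s\<close> is the outer
  and \<open>t\<close> the inner variable: the coefficient of \<open>s\<^sup>i t\<^sup>j\<close> in \<open>F\<close> is \<open>fps_nth (fps_nth F i) j\<close>.
  The ring of formal power series in \<open>x\<close>, \<open>s\<close>, \<open>t\<close> is \<open>rat fps fps fps\<close>, with \<open>x\<close> outermost.\<close>

abbreviation var_s :: "rat fps fps" where
  "var_s \<equiv> fps_X"

abbreviation var_t :: "rat fps fps" where
  "var_t \<equiv> fps_const fps_X"

text \<open>\<open>double_series a\<close> is the sum of \<open>a i j s\<^sup>i t\<^sup>j\<close> over all \<open>i, j \<ge> 0\<close>.\<close>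

definition double_series :: "(nat \<Rightarrow> nat \<Rightarrow> 'a) \<Rightarrow> 'a fps fps" where
  "double_series a = Abs_fps (\<lambda>i. Abs_fps (\<lambda>j. a i j))"

text \<open>\<open>double_series_x F\<close> is the sum of \<open>F i j s\<^sup>i t\<^sup>j\<close> over all \<open>i, j \<ge> 0\<close>, where each \<open>F i j\<close> is a
  power series in \<open>x\<close>: the coefficient of \<open>x\<^sup>n s\<^sup>i t\<^sup>j\<close> is the coefficient of \<open>x\<^sup>n\<close> in \<open>F i j\<close>.\<close>

definition double_series_x :: "(nat \<Rightarrow> nat \<Rightarrow> 'a fps) \<Rightarrow> 'a fps fps fps" where
  "double_series_x F = Abs_fps (\<lambda>n. double_series (\<lambda>i j. fps_nth (F i j) n))"

text \<open>\<open>rat fps\<close> is not a field, but division in \<open>rat fps fps\<close> is division by a unit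
  whenever the constant term of the denominator is nonzero.\<close>

lemma fps_fps_divide_unit:
  fixes f g :: "rat fps fps"
  assumes "fps_nth (fps_nth g 0) 0 \<noteq> 0"
  shows "f / g * g = f"
proof -
  have g0: "fps_nth g 0 * inverse (fps_nth g 0) = 1"
    using assms by (rule inverse_mult_eq_1')
  have ne: "fps_nth g 0 \<noteq> 0" using assms by auto
  then have sd: "subdegree g = 0" by (simp add: subdegree_eq_0_iff)
  then have uf: "unit_factor g = g"
    by (simp add: fps_unit_factor_def)
  have "g * inverse g = 1"
    using fps_right_inverse[OF g0] by (simp add: fps_inverse_def[of g])
  then show ?thesis
    by (simp add: fps_divide_def sd uf mult.assoc mult.commute[of _ g])
qed

end

theory Submission
  imports Defs
begin

text \<open>
  Stembridge's enriched P-partitions, with the letters \<open>-1 < 1 < -2 < 2 < \<dots>\<close> coded as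
  \<open>0 < 1 < 2 < 3 < \<dots>\<close> (odd means positive): for a permutation \<open>p\<close> let \<open>\<Omega>\<^sub>p(m)\<close> count the weakly
  increasing words over the first \<open>2m\<close> letters in which a positive letter is repeated only along
  ascents of \<open>p\<close> and a negative letter only along descents. Adding one position at a time gives
  \<open>2 \<Sum>\<^sub>m \<Omega>\<^sub>p(m) t\<^sup>m = ((1+t)/(1-t))\<^bsup>n+1\<^esup> (4t/(1+t)\<^sup>2)\<^bsup>pk(p)+1\<^esup>\<close>. Standardization identifies the pairs of a
  permutation \<open>p\<close> and a word admissible for \<open>p\<^sup>-\<^sup>1\<close> with arbitrary words, so that
  \<open>\<Sum>\<^sub>p \<Omega>\<^sub>p(i) \<Omega>\<^bsub>p\<^sup>-\<^sup>1\<^esub>(j)\<close> counts multisets of \<open>n\<close> pairs of letters in which pairs of opposite signs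
  occur at most once; this is the coefficient of \<open>x\<^sup>n\<close> in \<open>((1+x)/(1-x))\<^bsup>2ij\<^esup>\<close>, whence (a) and (b).
  For (c), that power series \<open>f\<close> satisfies \<open>(1-x\<^sup>2) f' = 4ij f\<close>, which is the recurrence obtained by
  deleting an element and its image from an odd cycle, and standardization with positive letters
  only gives \<open>A\<^sub>k(t)/(1-t)\<^bsup>k+1\<^esup> = \<Sum>\<^sub>i i\<^sup>k t\<^sup>i\<close>.
\<close>

section \<open>Weakly increasing words with prescribed ties\<close>

text \<open>Words are extensional functions, so that each word is one function and cardinalities
  count words. \<open>T k v\<close> tells whether the letter \<open>v\<close> may stand at both
  \<open>k\<close> and \<open>Suc k\<close>. Letting it depend on position and letter makes one
  recursion serve words admissible for a permutation, first components of pairs of words, and coded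
  pairs.\<close>

definition tie_chains :: "(nat \<Rightarrow> nat \<Rightarrow> bool) \<Rightarrow> nat \<Rightarrow> nat \<Rightarrow> (nat \<Rightarrow> nat) set" where
  "tie_chains T n p = {f \<in> {1..n} \<rightarrow>\<^sub>E {..<p}.
     \<forall>k\<in>{1..<n}. f k < f (Suc k) \<or> f k = f (Suc k) \<and> T k (f k)}"

lemma finite_tie_chains [simp]: "finite (tie_chains T n p)"
proof (rule finite_subset)
  show "tie_chains T n p \<subseteq> {1..n} \<rightarrow>\<^sub>E {..<p}" by (auto simp: tie_chains_def)
qed (simp add: finite_PiE)

lemma tie_chains_less: "f \<in> tie_chains T n p \<Longrightarrow> k \<in> {1..n} \<Longrightarrow> f k < p"
  by (auto simp: tie_chains_def dest: PiE_mem)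

lemma tie_chains_undefined: "f \<in> tie_chains T n p \<Longrightarrow> k \<notin> {1..n} \<Longrightarrow> f k = undefined"
  unfolding tie_chains_def by (blast dest: PiE_arb)

lemma tie_chains_step:
  "f \<in> tie_chains T n p \<Longrightarrow> k \<in> {1..<n} \<Longrightarrow> f k < f (Suc k) \<or> f k = f (Suc k) \<and> T k (f k)"
  unfolding tie_chains_def by blast

lemma tie_chainsI:
  assumes "\<And>k. k \<in> {1..n} \<Longrightarrow> f k < p" "\<And>k. k \<notin> {1..n} \<Longrightarrow> f k = undefined"
    and "\<And>k. k \<in> {1..<n} \<Longrightarrow> f k < f (Suc k) \<or> f k = f (Suc k) \<and> T k (f k)"
  shows "f \<in> tie_chains T n p"
proof -
  have "f \<in> {1..n} \<rightarrow>\<^sub>E {..<p}" by (rule PiE_I) (use assms(1,2) in simp_all)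
  then show ?thesis using assms(3) unfolding tie_chains_def by blast
qed

lemma tie_chains_mono:
  assumes "f \<in> tie_chains T n p" "1 \<le> k" "k \<le> l" "l \<le> n"
  shows "f k \<le> f l"
  using assms(3,4)
proof (induction l rule: dec_induct)
  case (step l)
  have "l \<in> {1..<n}" using step assms(2) by auto
  then have "f l \<le> f (Suc l)" using tie_chains_step[OF assms(1), of l] by linarith
  with step show ?case by simp
qed simp

lemma tie_chains_0: "tie_chains T 0 p = {\<lambda>_. undefined}"
  by (auto simp: tie_chains_def)

lemma tie_chains_Suc_0: "tie_chains T (Suc n) 0 = {}"
proof -
  have False if "f \<in> tie_chains T (Suc n) 0" for f
    using tie_chains_less[OF that, of 1] by simp
  then show ?thesis by blast
qed

text \<open>Split by whether the last position carries the top letter \<open>p\<close>. If it does,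
  the word before it may still contain \<open>p\<close> exactly when a tie is allowed at
  \<open>n\<close>. For \<open>n = 0\<close> either alphabet gives just the empty word.\<close>

lemma tie_chains_Suc_Suc:
  "tie_chains T (Suc n) (Suc p) =
     tie_chains T (Suc n) p \<union> (\<lambda>f. f(Suc n := p)) ` tie_chains T n (if T n p then Suc p else p)"
  (is "_ = _ \<union> _ ` tie_chains T n ?q")
proof (intro equalityI subsetI)
  fix f assume f: "f \<in> tie_chains T (Suc n) (Suc p)"
  have last: "f k \<le> f (Suc n)" if "k \<in> {1..Suc n}" for k
    using tie_chains_mono[OF f, of k "Suc n"] that by simp
  show "f \<in> tie_chains T (Suc n) p \<union> (\<lambda>f. f(Suc n := p)) ` tie_chains T n ?q"
  proof (cases "f (Suc n) = p")
    case False
    then have "f (Suc n) < p" using tie_chains_less[OF f, of "Suc n"] by simp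
    then have small: "f k < p" if "k \<in> {1..Suc n}" for k using last[OF that] by simp
    show ?thesis
      by (intro UnI1 tie_chainsI)
        (fact small tie_chains_undefined[OF f] tie_chains_step[OF f])+
  next
    case True
    define g where "g = f(Suc n := undefined)"
    have g: "g k = f k" if "k \<in> {1..n}" for k using that by (simp add: g_def)
    have small: "f k < ?q" if "k \<in> {1..n}" for k
    proof (cases "T n p")
      case True
      then show ?thesis using tie_chains_less[OF f, of k] that by simp
    next
      case False
      have "n \<in> {1..<Suc n}" using that by simp
      then have "f n < p" using tie_chains_step[OF f, of n] False True by auto
      moreover have "f k \<le> f n" using tie_chains_mono[OF f, of k n] that by simp
      ultimately show ?thesis using False by simp
    qed
    have "g \<in> tie_chains T n ?q"
    proof (rule tie_chainsI)
      fix k assume "k \<in> {1..n}"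
      then show "g k < ?q" using small[of k] g[of k] by simp
    next
      fix k assume "k \<notin> {1..n}"
      then show "g k = undefined"
        using tie_chains_undefined[OF f, of k] by (cases "k = Suc n") (auto simp: g_def)
    next
      fix k assume "k \<in> {1..<n}"
      then show "g k < g (Suc k) \<or> g k = g (Suc k) \<and> T k (g k)"
        using tie_chains_step[OF f, of k] g[of k] g[of "Suc k"] by simp
    qed
    moreover have "f = g(Suc n := p)" using True by (auto simp: g_def)
    ultimately show ?thesis by blast
  qed
next
  fix f assume "f \<in> tie_chains T (Suc n) p \<union> (\<lambda>f. f(Suc n := p)) ` tie_chains T n ?q"
  then show "f \<in> tie_chains T (Suc n) (Suc p)"
  proof
    assume f: "f \<in> tie_chains T (Suc n) p"
    show ?thesis
      by (rule tie_chainsI)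
        (fact tie_chains_less[OF f, THEN less_SucI] tie_chains_undefined[OF f] tie_chains_step[OF f])+
  next
    assume "f \<in> (\<lambda>f. f(Suc n := p)) ` tie_chains T n ?q"
    then obtain g where g: "g \<in> tie_chains T n ?q" and f: "f = g(Suc n := p)" by blast
    show ?thesis
    proof (rule tie_chainsI)
      fix k assume "k \<in> {1..Suc n}"
      then show "f k < Suc p"
        using tie_chains_less[OF g, of k] by (cases "k = Suc n"; cases "T n p") (simp_all add: f)
    next
      fix k assume "k \<notin> {1..Suc n}"
      then show "f k = undefined" using tie_chains_undefined[OF g, of k] by (auto simp: f)
    next
      fix k assume k: "k \<in> {1..<Suc n}"
      show "f k < f (Suc k) \<or> f k = f (Suc k) \<and> T k (f k)"
      proof (cases "k = n")
        case True
        have "g n < p \<or> g n = p \<and> T n p"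
          using tie_chains_less[OF g, of n] k True by (cases "T n p") (simp_all, linarith)
        then show ?thesis using True by (auto simp: f)
      next
        case False
        then show ?thesis using tie_chains_step[OF g, of k] k by (simp add: f)
      qed
    qed
  qed
qed

text \<open>All generating functions of words below come from this recursion; the two classes of
  words are disjoint because of their last letter.\<close>

lemma card_tie_chains_Suc_Suc:
  "card (tie_chains T (Suc n) (Suc p)) =
     card (tie_chains T (Suc n) p) + card (tie_chains T n (if T n p then Suc p else p))"
proof -
  let ?C = "tie_chains T n (if T n p then Suc p else p)"
  have "inj_on (\<lambda>f. f(Suc n := p)) ?C"
  proof (rule inj_onI)
    fix f g assume fg: "f \<in> ?C" "g \<in> ?C" "f(Suc n := p) = g(Suc n := p)"
    have "f (Suc n) = g (Suc n)"
      using fg(1,2)[THEN tie_chains_undefined, of "Suc n"] by simp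
    with fg(3) show "f = g" by (metis fun_upd_triv fun_upd_upd)
  qed
  then have "card ((\<lambda>f. f(Suc n := p)) ` ?C) = card ?C" by (rule card_image)
  moreover have "tie_chains T (Suc n) p \<inter> (\<lambda>f. f(Suc n := p)) ` ?C = {}"
  proof -
    have "f (Suc n) \<noteq> p" if "f \<in> tie_chains T (Suc n) p" for f
      using tie_chains_less[OF that, of "Suc n"] by simp
    then show ?thesis by (metis (no_types, lifting) disjoint_iff fun_upd_same imageE)
  qed
  ultimately show ?thesis
    unfolding tie_chains_Suc_Suc by (subst card_Un_disjoint) simp_all
qed

section \<open>Standardization\<close>

text \<open>For injective \<open>q\<close>: positive letters tie along ascents of \<open>q\<close>, the others along descents.\<close>

definition ties :: "(nat \<Rightarrow> bool) \<Rightarrow> (nat \<Rightarrow> nat) \<Rightarrow> nat \<Rightarrow> nat \<Rightarrow> bool" where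
  "ties pos q k v \<longleftrightarrow> (q k < q (Suc k)) = pos v"

text \<open>The positions whose value is at most \<open>p k\<close> are mapped bijectively onto
  \<open>{1..p k}\<close>. Hence the relative order of its values determines a permutation.\<close>

lemma permutes_interval_eq_rank:
  fixes p :: "nat \<Rightarrow> nat"
  assumes "p permutes {1..n}" "k \<in> {1..n}"
  shows "p k = card {l \<in> {1..n}. p l \<le> p k}"
proof -
  have "p k \<in> {1..n}" using permutes_in_image[OF assms(1), of k] assms(2) by simp
  have "p ` {l \<in> {1..n}. p l \<le> p k} = {1..p k}"
  proof (intro equalityI subsetI)
    fix v assume v: "v \<in> {1..p k}"
    then have "v \<in> {1..n}" using \<open>p k \<in> {1..n}\<close> by auto
    then have "v \<in> p ` {1..n}" using permutes_image[OF assms(1)] by simp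
    then obtain l where "l \<in> {1..n}" "v = p l" by blast
    with v show "v \<in> p ` {l \<in> {1..n}. p l \<le> p k}" by auto
  next
    fix v assume "v \<in> p ` {l \<in> {1..n}. p l \<le> p k}"
    then obtain l where "l \<in> {1..n}" "p l \<le> p k" "v = p l" by blast
    moreover have "p l \<in> {1..n}" using permutes_in_image[OF assms(1), of l] \<open>l \<in> {1..n}\<close> by simp
    ultimately show "v \<in> {1..p k}" by simp
  qed
  moreover have "card (p ` {l \<in> {1..n}. p l \<le> p k}) = card {l \<in> {1..n}. p l \<le> p k}"
    using permutes_inj_on[OF assms(1)] by (rule card_image)
  ultimately show ?thesis by simp
qed

lemma permutes_interval_eqI:
  fixes p q :: "nat \<Rightarrow> nat"
  assumes p: "p permutes {1..n}" and q: "q permutes {1..n}"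
    and less: "\<And>k l. k \<in> {1..n} \<Longrightarrow> l \<in> {1..n} \<Longrightarrow> k < l \<Longrightarrow> p k < p l \<longleftrightarrow> q k < q l"
  shows "p = q"
proof
  fix k
  show "p k = q k"
  proof (cases "k \<in> {1..n}")
    case True
    have "p l \<le> p k \<longleftrightarrow> q l \<le> q k" if "l \<in> {1..n}" for l
    proof (cases rule: linorder_cases[of l k])
      case less
      then have "p l \<noteq> p k" "q l \<noteq> q k" using p q by (auto dest!: permutes_inj simp: inj_eq)
      then show ?thesis using assms(3)[OF that True less] by linarith
    next
      case greater
      then have "p l \<noteq> p k" "q l \<noteq> q k" using p q by (auto dest!: permutes_inj simp: inj_eq)
      then show ?thesis using assms(3)[OF True that greater] by linarith
    qed simp
    then have "{l \<in> {1..n}. p l \<le> p k} = {l \<in> {1..n}. q l \<le> q k}" by blast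
    then show ?thesis
      using permutes_interval_eq_rank[OF p True] permutes_interval_eq_rank[OF q True] by argo
  qed (use p q in \<open>simp add: permutes_not_in\<close>)
qed

text \<open>The order in which standardization numbers two occurrences, the letter \<open>v\<close> preceding \<open>w\<close> in the
  word.\<close>

definition std_less :: "(nat \<Rightarrow> bool) \<Rightarrow> nat \<Rightarrow> nat \<Rightarrow> bool" where
  "std_less pos v w \<longleftrightarrow> v < w \<or> v = w \<and> pos v"

text \<open>On a constant stretch of \<open>c\<close> every step is a tie, hence an ascent of
  \<open>inv p\<close> if the letter is positive and a descent otherwise; so \<open>inv p\<close> is
  monotone along the stretch.\<close>

lemma tie_chains_ties_inv_strict:
  assumes p: "p permutes {1..n}" and c: "c \<in> tie_chains (ties pos (inv p)) n m"
    and u: "1 \<le> u" "u \<le> n" and v: "u < v" "v \<le> n" and eq: "c u = c v"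
  shows "if pos (c u) then inv p u < inv p v else inv p v < inv p u"
  using v(1)[THEN Suc_leI] v(2) eq
proof (induction v rule: dec_induct)
  have ip: "inv p a \<noteq> inv p b" if "a \<noteq> b" for a b
    using that permutes_inj[OF permutes_inv[OF p]] by (simp add: inj_eq)
  {
    case base
    then have "u \<in> {1..<n}" using u by auto
    then have "ties pos (inv p) u (c u)" using tie_chains_step[OF c, of u] base by auto
    then show ?case using ip[of u "Suc u"] by (auto simp: ties_def)
  next
    case (step v)
    have "c u \<le> c v" using tie_chains_mono[OF c u(1), of v] step by auto
    moreover have "c v \<le> c (Suc v)" using tie_chains_mono[OF c, of v "Suc v"] step u by auto
    ultimately have eq: "c u = c v" "c v = c (Suc v)" using step by auto
    have "v \<in> {1..<n}" using step u by auto
    then have "ties pos (inv p) v (c v)" using tie_chains_step[OF c, of v] eq by auto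
    then have "if pos (c u) then inv p v < inv p (Suc v) else inv p (Suc v) < inv p v"
      using ip[of v "Suc v"] eq by (auto simp: ties_def)
    moreover have "if pos (c u) then inv p u < inv p v else inv p v < inv p u"
      using step eq by auto
    ultimately show ?case by (auto split: if_splits)
  }
qed

text \<open>This says that \<open>p\<close> is the standardization of the word with letters
  \<open>c (p k)\<close>. Different letters are ordered since \<open>c\<close> is weakly increasing,
  equal ones by the monotonicity of \<open>inv p\<close> on constant stretches.\<close>

lemma tie_chains_ties_inv_less_iff:
  assumes p: "p permutes {1..n}" and c: "c \<in> tie_chains (ties pos (inv p)) n m"
    and kl: "k \<in> {1..n}" "l \<in> {1..n}" "k < l"
  shows "p k < p l \<longleftrightarrow> std_less pos (c (p k)) (c (p l))"
proof -
  have in_n: "p k \<in> {1..n}" "p l \<in> {1..n}"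
    using permutes_in_image[OF p, of k] permutes_in_image[OF p, of l] kl by simp_all
  have inv: "inv p (p k) = k" "inv p (p l) = l"
    using permutes_inverses[OF p] by auto
  have "p k \<noteq> p l" using kl(3) inv by (metis less_irrefl)
  then consider "p k < p l" | "p l < p k" by linarith
  then show ?thesis
  proof cases
    case 1
    then have "c (p k) \<le> c (p l)" using tie_chains_mono[OF c] in_n by auto
    moreover have "pos (c (p k))" if "c (p k) = c (p l)"
      using tie_chains_ties_inv_strict[OF p c, of "p k" "p l"] 1 in_n that kl(3)
      by (auto simp: inv split: if_splits)
    ultimately show ?thesis using 1 by (auto simp: std_less_def)
  next
    case 2
    then have "c (p l) \<le> c (p k)" using tie_chains_mono[OF c] in_n by auto
    moreover have "\<not> pos (c (p k))" if "c (p k) = c (p l)"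
      using tie_chains_ties_inv_strict[OF p c, of "p l" "p k"] 2 in_n that kl(3)
      by (auto simp: inv split: if_splits)
    ultimately show ?thesis using 2 by (auto simp: std_less_def)
  qed
qed

text \<open>The relation \<open>before\<close> is a strict total order on positions: by letter, then
  left to right for positive letters and right to left for the others. The permutation numbers the
  positions in this order.\<close>

lemma standardization_exists:
  fixes b :: "nat \<Rightarrow> nat"
  obtains p where "p permutes {1..n}"
    "\<And>k l. k \<in> {1..n} \<Longrightarrow> l \<in> {1..n} \<Longrightarrow> k < l \<Longrightarrow> p k < p l \<longleftrightarrow> std_less pos (b k) (b l)"
proof -
  define before where
    "before l k \<longleftrightarrow> b l < b k \<or> b l = b k \<and> (if pos (b k) then l < k else k < l)" for l k
  have trans: "before k m" if "before k l" "before l m" for k l m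
    using that by (auto simp: before_def split: if_splits)
  have irrefl: "\<not> before k k" for k by (auto simp: before_def)
  have total: "before k l \<or> before l k" if "k \<noteq> l" for k l
    using that by (auto simp: before_def)
  define p where "p k = (if k \<in> {1..n} then Suc (card {l \<in> {1..n}. before l k}) else k)" for k
  have mono: "p k < p l" if "k \<in> {1..n}" "l \<in> {1..n}" "before k l" for k l
  proof -
    have "{j \<in> {1..n}. before j k} \<subseteq> {j \<in> {1..n}. before j l}"
      using trans[OF _ that(3)] by blast
    moreover have "k \<in> {j \<in> {1..n}. before j l}" "k \<notin> {j \<in> {1..n}. before j k}"
      using that irrefl by auto
    ultimately have "{j \<in> {1..n}. before j k} \<subset> {j \<in> {1..n}. before j l}" by blast
    then have "card {j \<in> {1..n}. before j k} < card {j \<in> {1..n}. before j l}"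
      by (rule psubset_card_mono[rotated]) simp
    then show ?thesis using that by (simp add: p_def)
  qed
  have inj: "inj_on p {1..n}"
  proof (rule inj_onI)
    fix k l assume kl: "k \<in> {1..n}" "l \<in> {1..n}" "p k = p l"
    show "k = l"
    proof (rule ccontr)
      assume "k \<noteq> l"
      then show False using total[of k l] mono[OF kl(1,2)] mono[OF kl(2,1)] kl(3) by auto
    qed
  qed
  have "p k \<in> {1..n}" if "k \<in> {1..n}" for k
  proof -
    have "{l \<in> {1..n}. before l k} \<subset> {1..n}" using that irrefl by blast
    then have "card {l \<in> {1..n}. before l k} < card {1..n}"
      by (rule psubset_card_mono[rotated]) simp
    then show ?thesis using that by (simp add: p_def)
  qed
  then have "p ` {1..n} \<subseteq> {1..n}" by blast
  then have "p ` {1..n} = {1..n}" using inj by (intro endo_inj_surj) simp_all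
  then have perm: "p permutes {1..n}"
    using inj by (intro bij_imp_permutes) (auto simp: bij_betw_def p_def)
  have "p k < p l \<longleftrightarrow> std_less pos (b k) (b l)"
    if kl: "k \<in> {1..n}" "l \<in> {1..n}" "k < l" for k l
  proof (cases "before k l")
    case True
    then show ?thesis using mono[OF kl(1,2)] kl(3)
      by (auto simp: before_def std_less_def split: if_splits)
  next
    case False
    then have "before l k" using total[of k l] kl(3) by simp
    then show ?thesis using mono[OF kl(2,1)] False kl(3)
      by (auto simp: before_def std_less_def split: if_splits)
  qed
  with perm show ?thesis by (rule that)
qed

text \<open>Injectivity: the word determines \<open>p\<close> through the relative order of its
  values, and then \<open>c\<close> by composing with \<open>inv p\<close>. Surjectivity:
  standardize the word and sort its letters.\<close>

lemma bij_betw_standardization: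
  "bij_betw (\<lambda>(p, c). restrict (\<lambda>k. c (p k)) {1..n})
     (SIGMA p:{p. p permutes {1..n}}. tie_chains (ties pos (inv p)) n m) ({1..n} \<rightarrow>\<^sub>E {..<m})"
  (is "bij_betw ?f ?A ?B")
proof (rule bij_betwI')
  fix x y assume "x \<in> ?A" "y \<in> ?A"
  then obtain p c q d where xy: "x = (p, c)" "y = (q, d)"
    and p: "p permutes {1..n}" and c: "c \<in> tie_chains (ties pos (inv p)) n m"
    and q: "q permutes {1..n}" and d: "d \<in> tie_chains (ties pos (inv q)) n m"
    by auto
  have "x = y" if "?f x = ?f y"
  proof -
    have eq: "c (p k) = d (q k)" if "k \<in> {1..n}" for k
      using fun_cong[OF \<open>?f x = ?f y\<close>, of k] that by (simp add: xy)
    have "p = q"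
    proof (rule permutes_interval_eqI[OF p q])
      fix k l assume kl: "k \<in> {1..n}" "l \<in> {1..n}" "k < l"
      then show "p k < p l \<longleftrightarrow> q k < q l"
        using tie_chains_ties_inv_less_iff[OF p c kl] tie_chains_ties_inv_less_iff[OF q d kl] eq
        by simp
    qed
    moreover have "c = d"
    proof (rule PiE_ext)
      show "c \<in> {1..n} \<rightarrow>\<^sub>E {..<m}" "d \<in> {1..n} \<rightarrow>\<^sub>E {..<m}"
        using c d by (auto simp: tie_chains_def)
      fix k assume "k \<in> {1..n}"
      then have "inv p k \<in> {1..n}"
        using permutes_in_image[OF permutes_inv[OF p], of k] by simp
      then show "c k = d k"
        using eq[of "inv p k"] \<open>p = q\<close> permutes_inverses(1)[OF p] by auto
    qed
    ultimately show ?thesis by (simp add: xy)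
  qed
  then show "?f x = ?f y \<longleftrightarrow> x = y" by auto
next
  fix x assume "x \<in> ?A"
  then obtain p c where x: "x = (p, c)"
    and p: "p permutes {1..n}" and c: "c \<in> tie_chains (ties pos (inv p)) n m"
    by auto
  have "c (p k) < m" if "k \<in> {1..n}" for k
  proof -
    have "p k \<in> {1..n}" using permutes_in_image[OF p, of k] that by simp
    then show ?thesis using tie_chains_less[OF c] by blast
  qed
  then show "?f x \<in> ?B" by (simp add: x restrict_PiE_iff)
next
  fix b assume b: "b \<in> ?B"
  obtain p where p: "p permutes {1..n}" and
    less: "\<And>k l. k \<in> {1..n} \<Longrightarrow> l \<in> {1..n} \<Longrightarrow> k < l \<Longrightarrow> p k < p l \<longleftrightarrow> std_less pos (b k) (b l)"
    using standardization_exists[of n pos b] by blast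
  have inv: "inv p (p k) = k" "p (inv p k) = k" for k
    using permutes_inverses[OF p] by auto
  have inv_in: "inv p k \<in> {1..n} \<longleftrightarrow> k \<in> {1..n}" for k
    using permutes_in_image[OF permutes_inv[OF p]] .
  have p_in: "p k \<in> {1..n} \<longleftrightarrow> k \<in> {1..n}" for k
    using permutes_in_image[OF p] .
  \<comment> \<open>Position \<open>inv p k\<close> is the one numbered \<open>k\<close>, so
    \<open>c\<close> is \<open>b\<close> sorted. Neighbours in \<open>c\<close> with the same letter
    come from positions in increasing order exactly if the letter is positive, which is the tie
    condition.\<close>
  define c where "c = restrict (\<lambda>k. b (inv p k)) {1..n}"
  have "c k < c (Suc k) \<or> c k = c (Suc k) \<and> ties pos (inv p) k (c k)" if "k \<in> {1..<n}" for k
  proof -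
    have k: "k \<in> {1..n}" "Suc k \<in> {1..n}" using that by auto
    then have c: "c k = b (inv p k)" "c (Suc k) = b (inv p (Suc k))" by (auto simp: c_def)
    have ik: "inv p k \<in> {1..n}" "inv p (Suc k) \<in> {1..n}" using k inv_in by blast+
    have "inv p k \<noteq> inv p (Suc k)" using inv(2) by (metis n_not_Suc_n)
    then consider "inv p k < inv p (Suc k)" | "inv p (Suc k) < inv p k" by linarith
    then show ?thesis
    proof cases
      case 1
      then show ?thesis using less[OF ik] by (auto simp: inv c std_less_def ties_def)
    next
      case 2
      then show ?thesis using less[OF ik(2,1)] by (auto simp: inv c std_less_def ties_def)
    qed
  qed
  moreover have "c \<in> {1..n} \<rightarrow>\<^sub>E {..<m}"
    unfolding c_def using b inv_in by (subst restrict_PiE_iff) (blast dest: PiE_mem)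
  ultimately have "c \<in> tie_chains (ties pos (inv p)) n m" unfolding tie_chains_def by blast
  moreover have "b = ?f (p, c)"
  proof
    fix k
    show "b k = ?f (p, c) k"
    proof (cases "k \<in> {1..n}")
      case True
      then show ?thesis using p_in[of k] inv by (simp add: c_def)
    next
      case False
      then show ?thesis using PiE_arb[OF b False] by auto
    qed
  qed
  ultimately show "\<exists>x\<in>?A. b = ?f x" using p by (intro bexI[of _ "(p, c)"]) simp_all
qed

section \<open>Pairs of words\<close>

lemma tie_chains_cong:
  assumes "\<And>k v. k \<in> {1..<n} \<Longrightarrow> T k v \<longleftrightarrow> T' k v"
  shows "tie_chains T n p = tie_chains T' n p"
  using assms unfolding tie_chains_def by blast

text \<open>Pairs of letters are numbered lexicographically, the second letter being reversed when the
  first one is even; repetition of a pair is then allowed exactly for odd numbers.\<close>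

definition pair_code :: "nat \<Rightarrow> nat \<Rightarrow> nat \<Rightarrow> nat" where
  "pair_code j a b = 2 * j * a + (if odd a then b else 2 * j - 1 - b)"

definition pair_snd :: "nat \<Rightarrow> nat \<Rightarrow> nat" where
  "pair_snd j v = (if odd (v div (2 * j)) then v mod (2 * j) else 2 * j - 1 - v mod (2 * j))"

lemma pair_code_div: "b < 2 * j \<Longrightarrow> pair_code j a b div (2 * j) = a"
  by (auto simp: pair_code_def)

lemma pair_code_snd: "b < 2 * j \<Longrightarrow> pair_snd j (pair_code j a b) = b"
proof -
  assume b: "b < 2 * j"
  then have "pair_code j a b mod (2 * j) = (if odd a then b else 2 * j - 1 - b)"
    unfolding pair_code_def by (subst mod_mult_self4) auto
  then show ?thesis using b by (simp add: pair_snd_def pair_code_div)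
qed

lemma pair_code_less:
  assumes "a < 2 * i" "b < 2 * j"
  shows "pair_code j a b < 4 * i * j"
proof -
  have "2 * j * a + 2 * j \<le> 4 * i * j"
    using mult_le_mono2[of "Suc a" "2 * i" "2 * j"] assms(1) by (simp add: algebra_simps)
  then show ?thesis using assms(2) by (auto simp: pair_code_def)
qed

lemma pair_code_inverse:
  assumes "v < 4 * i * j"
  shows "v div (2 * j) < 2 * i" "pair_snd j v < 2 * j" "pair_code j (v div (2 * j)) (pair_snd j v) = v"
proof -
  have j: "j > 0" using assms by (cases j) auto
  then have mod: "v mod (2 * j) < 2 * j" by simp
  show "v div (2 * j) < 2 * i"
    using assms j by (intro div_less_iff_less_mult[THEN iffD2]) (auto simp: algebra_simps)
  show "pair_snd j v < 2 * j" using mod j by (auto simp: pair_snd_def)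
  have "2 * j - 1 - (2 * j - 1 - v mod (2 * j)) = v mod (2 * j)" using mod by linarith
  then show "pair_code j (v div (2 * j)) (pair_snd j v) = v"
    unfolding pair_code_def pair_snd_def by simp
qed

text \<open>Codes with first letter \<open>a\<close> form a block of length \<open>2 * j\<close>. In
  a block with \<open>a\<close> odd, the code has the order and the parity of \<open>b\<close>. In
  one with \<open>a\<close> even, both are reversed, and a permitted step becomes the negation of
  \<open>std_less odd b b'\<close>.\<close>

lemma pair_code_step_iff:
  assumes "b < 2 * j" "b' < 2 * j"
  shows "pair_code j a b < pair_code j a' b' \<or> pair_code j a b = pair_code j a' b' \<and> odd (pair_code j a b)
    \<longleftrightarrow> a < a' \<or> a = a' \<and> (std_less odd b b' \<longleftrightarrow> odd a)"
proof (cases rule: linorder_cases[of a a'])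
  case less
  have "2 * j * a + 2 * j \<le> 2 * j * a'"
    using mult_le_mono2[of "Suc a" a' "2 * j"] less by (simp add: algebra_simps)
  then have "pair_code j a b < pair_code j a' b'" using assms by (auto simp: pair_code_def)
  then show ?thesis using less by simp
next
  case equal
  have "odd (2 * j - 1 - b) \<longleftrightarrow> even b" using assms(1) by auto
  moreover have "2 * j - 1 - b < 2 * j - 1 - b' \<longleftrightarrow> b' < b" "2 * j - 1 - b = 2 * j - 1 - b' \<longleftrightarrow> b = b'"
    using assms by linarith+
  ultimately show ?thesis using equal
    by (cases rule: linorder_cases[of b b']) (simp_all add: pair_code_def std_less_def)
next
  case greater
  have "2 * j * a' + 2 * j \<le> 2 * j * a"
    using mult_le_mono2[of "Suc a'" a "2 * j"] greater by (simp add: algebra_simps)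
  then have "pair_code j a' b' < pair_code j a b" using assms by (auto simp: pair_code_def)
  then show ?thesis using greater by simp
qed

text \<open>Coding letter by letter turns the condition linking \<open>a\<close> to \<open>b\<close>
  into a condition on one word. A code is odd exactly when its two letters have the same sign, so
  only such pairs may be repeated.\<close>

lemma card_pairs_of_words:
  "card (SIGMA b:{1..n} \<rightarrow>\<^sub>E {..<2 * j}.
       tie_chains (\<lambda>k v. std_less odd (b k) (b (Suc k)) \<longleftrightarrow> odd v) n (2 * i)) =
     card (tie_chains (\<lambda>_ v. odd v) n (4 * i * j))"
  (is "card ?A = card ?B")
proof (rule bij_betw_same_card)
  let ?f = "\<lambda>(b, a). restrict (\<lambda>k. pair_code j (a k) (b k)) {1..n}"
  let ?g = "\<lambda>f. (restrict (\<lambda>k. pair_snd j (f k)) {1..n}, restrict (\<lambda>k. f k div (2 * j)) {1..n})"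
  show "bij_betw ?f ?A ?B"
  proof (rule bij_betw_byWitness[where f' = ?g])
    show "\<forall>x\<in>?A. ?g (?f x) = x"
    proof
      fix x assume "x \<in> ?A"
      then obtain b a where x: "x = (b, a)" and b: "b \<in> {1..n} \<rightarrow>\<^sub>E {..<2 * j}"
        and a: "a \<in> tie_chains (\<lambda>k v. std_less odd (b k) (b (Suc k)) \<longleftrightarrow> odd v) n (2 * i)"
        by blast
      have bl: "b k < 2 * j" if "k \<in> {1..n}" for k using PiE_mem[OF b that] by simp
      have "restrict (\<lambda>k. pair_snd j (?f x k)) {1..n} k = b k" for k
        using bl[of k] PiE_arb[OF b, of k] by (auto simp: x pair_code_snd restrict_def)
      moreover have "restrict (\<lambda>k. ?f x k div (2 * j)) {1..n} k = a k" for k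
        using bl[of k] tie_chains_undefined[OF a, of k] by (auto simp: x pair_code_div restrict_def)
      ultimately show "?g (?f x) = x" by (simp add: x fun_eq_iff)
    qed
    show "\<forall>f\<in>?B. ?f (?g f) = f"
    proof
      fix f assume f: "f \<in> ?B"
      have "?f (?g f) k = f k" for k
        using tie_chains_less[OF f, of k, THEN pair_code_inverse(3)] tie_chains_undefined[OF f, of k]
        by (auto simp: restrict_def)
      then show "?f (?g f) = f" by blast
    qed
    show "?f ` ?A \<subseteq> ?B"
    proof (rule image_subsetI)
      fix x assume "x \<in> ?A"
      then obtain b a where x: "x = (b, a)" and b: "b \<in> {1..n} \<rightarrow>\<^sub>E {..<2 * j}"
        and a: "a \<in> tie_chains (\<lambda>k v. std_less odd (b k) (b (Suc k)) \<longleftrightarrow> odd v) n (2 * i)"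
        by blast
      have bl: "b k < 2 * j" if "k \<in> {1..n}" for k using PiE_mem[OF b that] by simp
      show "?f x \<in> ?B"
      proof (rule tie_chainsI)
        fix k assume k: "k \<in> {1..n}"
        then show "?f x k < 4 * i * j"
          using pair_code_less[OF tie_chains_less[OF a k] bl[OF k]] by (simp add: x)
      next
        fix k assume k: "k \<in> {1..<n}"
        then have k': "k \<in> {1..n}" "Suc k \<in> {1..n}" by auto
        show "?f x k < ?f x (Suc k) \<or> ?f x k = ?f x (Suc k) \<and> odd (?f x k)"
          using pair_code_step_iff[OF bl[OF k'(1)] bl[OF k'(2)], of "a k" "a (Suc k)"]
            tie_chains_step[OF a k] k' by (simp add: x)
      qed (auto simp: x)
    qed
    show "?g ` ?B \<subseteq> ?A"
    proof (rule image_subsetI)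
      fix f assume f: "f \<in> ?B"
      define b where "b = restrict (\<lambda>k. pair_snd j (f k)) {1..n}"
      define a where "a = restrict (\<lambda>k. f k div (2 * j)) {1..n}"
      have b: "b k = pair_snd j (f k)" and a: "a k = f k div (2 * j)" if "k \<in> {1..n}" for k
        using that by (auto simp: b_def a_def)
      note inv = tie_chains_less[OF f, THEN pair_code_inverse(1)]
        tie_chains_less[OF f, THEN pair_code_inverse(2)]
        tie_chains_less[OF f, THEN pair_code_inverse(3)]
      have "b \<in> {1..n} \<rightarrow>\<^sub>E {..<2 * j}"
        using inv(2) unfolding b_def by (subst restrict_PiE_iff) blast
      moreover have "a \<in> tie_chains (\<lambda>k v. std_less odd (b k) (b (Suc k)) \<longleftrightarrow> odd v) n (2 * i)"
      proof (rule tie_chainsI)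
        fix k assume k: "k \<in> {1..n}"
        then show "a k < 2 * i" using inv(1)[OF k] by (simp add: a)
      next
        fix k assume k: "k \<in> {1..<n}"
        then have k': "k \<in> {1..n}" "Suc k \<in> {1..n}" by auto
        show "a k < a (Suc k) \<or> a k = a (Suc k) \<and> (std_less odd (b k) (b (Suc k)) \<longleftrightarrow> odd (a k))"
          using pair_code_step_iff[OF inv(2)[OF k'(1)] inv(2)[OF k'(2)],
              of "f k div (2 * j)" "f (Suc k) div (2 * j)"]
            inv(3)[OF k'(1)] inv(3)[OF k'(2)] tie_chains_step[OF f k] k'
          by (simp add: a b)
      qed (auto simp: a_def)
      ultimately show "?g f \<in> ?A" unfolding a_def b_def by blast
    qed
  qed
qed

text \<open>Standardization trades \<open>p\<close> and the word admissible for \<open>inv p\<close>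
  for an arbitrary word \<open>b\<close>; what remains is to count the first words compatible with
  \<open>b\<close>.\<close>

lemma sum_card_tie_chains_inv:
  "(\<Sum>p | p permutes {1..n}.
      card (tie_chains (ties odd p) n (2 * i)) * card (tie_chains (ties odd (inv p)) n (2 * j))) =
     card (tie_chains (\<lambda>_ v. odd v) n (4 * i * j))"
proof -
  let ?S = "SIGMA p:{p. p permutes {1..n}}. tie_chains (ties odd (inv p)) n (2 * j)"
  let ?h = "\<lambda>(p, c). restrict (\<lambda>k. c (p k)) {1..n} :: nat \<Rightarrow> nat"
  let ?T = "\<lambda>b k v. std_less odd (b k) (b (Suc k)) \<longleftrightarrow> odd (v::nat)"
  have fin: "finite {p. p permutes {1..n}}" by (simp add: finite_permutations)
  have "(\<Sum>p | p permutes {1..n}.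
      card (tie_chains (ties odd p) n (2 * i)) * card (tie_chains (ties odd (inv p)) n (2 * j))) =
    (\<Sum>p | p permutes {1..n}. \<Sum>c\<in>tie_chains (ties odd (inv p)) n (2 * j).
      card (tie_chains (ties odd p) n (2 * i)))"
    by (simp add: mult.commute)
  also have "\<dots> = (\<Sum>(p, c)\<in>?S. card (tie_chains (ties odd p) n (2 * i)))"
    using fin by (subst sum.Sigma) auto
  \<comment> \<open>Ascents of \<open>p\<close> are the \<open>std_less\<close> steps of the word
    \<open>?h x\<close>, so the condition on the first word depends on \<open>p\<close> and
    \<open>c\<close> only through that word.\<close>
  also have "\<dots> = (\<Sum>x\<in>?S. card (tie_chains (?T (?h x)) n (2 * i)))"
  proof (rule sum.cong[OF refl])
    fix x assume "x \<in> ?S"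
    then obtain p c where x: "x = (p, c)" and p: "p permutes {1..n}"
      and c: "c \<in> tie_chains (ties odd (inv p)) n (2 * j)" by blast
    have "tie_chains (ties odd p) n (2 * i) = tie_chains (?T (?h x)) n (2 * i)"
    proof (rule tie_chains_cong)
      fix k v assume "k \<in> {1..<n}"
      then have k: "k \<in> {1..n}" "Suc k \<in> {1..n}" by auto
      show "ties odd p k v \<longleftrightarrow> ?T (?h x) k v"
        using tie_chains_ties_inv_less_iff[OF p c k] k by (simp add: x ties_def)
    qed
    then show "(case x of (p, c) \<Rightarrow> card (tie_chains (ties odd p) n (2 * i))) =
      card (tie_chains (?T (?h x)) n (2 * i))" by (simp add: x)
  qed
  also have "\<dots> = (\<Sum>b\<in>{1..n} \<rightarrow>\<^sub>E {..<2 * j}. card (tie_chains (?T b) n (2 * i)))"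
    using sum.reindex_bij_betw[OF bij_betw_standardization] .
  also have "\<dots> = card (SIGMA b:{1..n} \<rightarrow>\<^sub>E {..<2 * j}. tie_chains (?T b) n (2 * i))"
    by (rule card_SigmaI[symmetric]) (auto simp: finite_PiE)
  also have "\<dots> = card (tie_chains (\<lambda>_ v. odd v) n (4 * i * j))"
    by (rule card_pairs_of_words)
  finally show ?thesis .
qed

text \<open>Replacing \<open>p\<close> by its inverse permutes the summands; the sum then counts the
  pairs that standardization matches with all words of length \<open>n\<close>.\<close>

lemma sum_card_tie_chains_words:
  "(\<Sum>p | p permutes {1..n}. card (tie_chains (ties pos p) n m)) = m ^ n"
proof -
  let ?S = "SIGMA p:{p. p permutes {1..n}}. tie_chains (ties pos (inv p)) n m"
  have fin: "finite {p. p permutes {1..n}}" by (simp add: finite_permutations)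
  have "(\<Sum>p | p permutes {1..n}. card (tie_chains (ties pos p) n m)) =
    (\<Sum>p | p permutes {1..n}. card (tie_chains (ties pos (inv p)) n m))"
    by (rule sum_permutations_inverse)
  also have "\<dots> = card ?S"
    using fin by (simp add: card_SigmaI)
  also have "\<dots> = card ({1..n} \<rightarrow>\<^sub>E {..<m})"
    using bij_betw_standardization by (rule bij_betw_same_card)
  finally show ?thesis by (simp add: card_PiE)
qed

section \<open>Powers of (1 + x) / (1 - x)\<close>

unbundle fps_syntax

lemma one_minus_fps_X_neq_0: "1 - fps_X \<noteq> (0 :: 'a::comm_ring_1 fps)"
proof
  assume "1 - fps_X = (0 :: 'a fps)"
  then have "(1 - fps_X :: 'a fps) $ 0 = 0 $ 0" by (rule arg_cong)
  then show False by simp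
qed

lemma one_plus_X_over_one_minus_X:
  "(1 + fps_X) / (1 - fps_X) * (1 - fps_X) = (1 + fps_X :: rat fps)"
  by (simp add: fps_divide_unit inverse_mult_eq_1 mult.assoc)

text \<open>Here x marks the length of the word. A new top letter contributes 1 + x if it is even,
  being used at most once, and 1/(1 - x) if it is odd.\<close>

lemma fps_card_tie_chains_odd:
  "Abs_fps (\<lambda>n. of_nat (card (tie_chains (\<lambda>_ v. odd v) n (2 * r)))) =
     ((1 + fps_X) / (1 - fps_X) :: rat fps) ^ r"
proof -
  define H :: "nat \<Rightarrow> rat fps"
    where "H q = Abs_fps (\<lambda>n. of_nat (card (tie_chains (\<lambda>_ v. odd v) n q)))" for q
  have rec: "H (Suc q) = H q + fps_X * H (if odd q then Suc q else q)" for q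
  proof (rule fps_ext)
    fix n
    show "H (Suc q) $ n = (H q + fps_X * H (if odd q then Suc q else q)) $ n"
      by (cases n) (simp_all add: H_def tie_chains_0 card_tie_chains_Suc_Suc)
  qed
  have "H (2 * r) = ((1 + fps_X) / (1 - fps_X)) ^ r"
  proof (induction r)
    case 0
    have "H 0 $ n = 1 $ n" for n
      by (cases n) (simp_all add: H_def tie_chains_0 tie_chains_Suc_0)
    then show ?case by (simp add: fps_eq_iff)
  next
    case (Suc r)
    let ?R = "(1 + fps_X) / (1 - fps_X) :: rat fps"
    have "H (2 * Suc r) * (1 - fps_X) = H (2 * r) * (1 + fps_X)"
      using rec[of "2 * r"] rec[of "Suc (2 * r)"] by (simp add: algebra_simps)
    also have "\<dots> = H (2 * r) * (?R * (1 - fps_X))"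
      unfolding one_plus_X_over_one_minus_X ..
    also have "\<dots> = ?R ^ Suc r * (1 - fps_X)"
      unfolding Suc.IH by (simp only: power_Suc mult_ac)
    finally show ?case using one_minus_fps_X_neq_0 by (metis mult_right_cancel)
  qed
  then show ?thesis by (simp add: H_def)
qed

lemma fps_nth_one_plus_X_over_one_minus_X_power:
  "fps_nth (((1 + fps_X) / (1 - fps_X) :: rat fps) ^ N) n =
     (\<Sum>k=0..n. of_nat (N choose k) * of_nat ((N + n - k - 1) choose (n - k)))"
proof -
  have "((1 + fps_X) / (1 - fps_X) :: rat fps) ^ N = (1 + fps_X) ^ N * inverse ((1 - fps_X) ^ N)"
    by (simp add: fps_divide_unit power_mult_distrib fps_inverse_power)
  also have "(1 + fps_X :: rat fps) ^ N = fps_binomial (of_nat N)"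
    by (simp add: fps_binomial_of_nat)
  also have "inverse ((1 - fps_X :: rat fps) ^ N) = Abs_fps (\<lambda>k. of_nat ((N + k - 1) choose k))"
    \<comment> \<open>For \<open>N = 0\<close> truncated subtraction makes the binomial coefficient
      1 at \<open>k = 0\<close> and 0 elsewhere, as it must be for the series 1.\<close>
    using one_minus_const_fps_X_neg_power'[of N "1 :: rat"] by (cases "N = 0") (auto simp: fps_eq_iff)
  finally show ?thesis
    by (auto simp: fps_mult_nth binomial_gbinomial intro!: sum.cong)
qed

lemma one_plus_X_over_one_minus_X_power_ode:
  fixes R :: "'a::idom fps"
  assumes R: "R * (1 - fps_X) = 1 + fps_X"
  shows "(1 - fps_X) * (1 + fps_X) * fps_deriv (R ^ N) = of_nat (2 * N) * R ^ N"
proof -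
  have "fps_deriv (R * (1 - fps_X)) = fps_deriv (1 + fps_X)" unfolding R ..
  then have "fps_deriv R * (1 - fps_X) = 1 + R" by (simp add: algebra_simps)
  \<comment> \<open>By the hypothesis on \<open>R\<close>, (1 - x)(1 + R) = 2; multiplying by 1 + x
    = R(1 - x) gives the right-hand side.\<close>
  then have "(1 - fps_X) * ((1 - fps_X) * (1 + fps_X) * fps_deriv R) = (1 - fps_X) * (2 * R)"
    using R by algebra
  then have dR: "(1 - fps_X) * (1 + fps_X) * fps_deriv R = 2 * R"
    using one_minus_fps_X_neq_0 by (metis mult_left_cancel)
  show ?thesis
  proof (induction N)
    case (Suc N)
    have "(1 - fps_X) * (1 + fps_X) * fps_deriv (R ^ Suc N) =
      R * ((1 - fps_X) * (1 + fps_X) * fps_deriv (R ^ N)) +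
      (1 - fps_X) * (1 + fps_X) * fps_deriv R * R ^ N"
      by (simp add: algebra_simps)
    also have "\<dots> = of_nat (2 * Suc N) * R ^ Suc N"
      unfolding Suc.IH dR by (simp add: algebra_simps)
    finally show ?case .
  qed simp
qed

lemma fps_nth_one_plus_X_over_one_minus_X_power_rec:
  fixes N :: nat
  defines "f \<equiv> ((1 + fps_X) / (1 - fps_X) :: rat fps) ^ N"
  shows "fps_nth f 0 = 1" "fps_nth f 1 = 2 * of_nat N"
    "of_nat (n + 2) * fps_nth f (n + 2) = 2 * of_nat N * fps_nth f (n + 1) + of_nat n * fps_nth f n"
proof -
  have "(1 - fps_X) * (1 + fps_X) * fps_deriv f = of_nat (2 * N) * f"
    unfolding f_def
    by (rule one_plus_X_over_one_minus_X_power_ode[OF one_plus_X_over_one_minus_X])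
  then have ode: "fps_deriv f = fps_X * (fps_X * fps_deriv f) + fps_const (of_nat (2 * N)) * f"
    unfolding fps_of_nat by (simp add: algebra_simps)
  show f0: "fps_nth f 0 = 1" by (simp add: f_def fps_divide_unit fps_power_zeroth)
  show "fps_nth f 1 = 2 * of_nat N"
    using arg_cong[OF ode, of "\<lambda>g. fps_nth g 0"] f0 by simp
  \<comment> \<open>Compare coefficients of x to the power \<open>n + 1\<close>. For
    \<open>n = 0\<close> the term with two factors \<open>fps_X\<close> contributes nothing, in
    agreement with the factor \<open>of_nat n\<close>.\<close>
  show "of_nat (n + 2) * fps_nth f (n + 2) = 2 * of_nat N * fps_nth f (n + 1) + of_nat n * fps_nth f n"
    using arg_cong[OF ode, of "\<lambda>g. fps_nth g (n + 1)"]
    by (cases n) (simp_all add: algebra_simps)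
qed

section \<open>Peaks, descents and enriched words\<close>

text \<open>Lengthening the permutation makes position \<open>k\<close> interior, and this is the
  only new candidate for a peak.\<close>

lemma pk_Suc:
  assumes "k \<ge> 1"
  shows "pk (Suc k) p =
    (if k \<ge> 2 \<and> p (k - 1) < p k \<and> p (Suc k) < p k then Suc (pk k p) else pk k p)"
proof -
  have "{i \<in> {2..Suc k - 1}. Q i} = {i \<in> {2..k - 1}. Q i} \<union> (if k \<ge> 2 \<and> Q k then {k} else {})" for Q
  proof -
    have "i \<le> k \<longleftrightarrow> i \<le> k - 1 \<or> i = k" for i using assms by auto
    then show ?thesis by auto
  qed
  then show ?thesis using assms by (simp add: pk_def)
qed

lemma des_Suc:
  assumes "k \<ge> 1"
  shows "des (Suc k) p = (if p (Suc k) < p k then Suc (des k p) else des k p)"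
proof -
  have "{i \<in> {1..Suc k - 1}. Q i} = {i \<in> {1..k - 1}. Q i} \<union> (if Q k then {k} else {})" for Q
  proof -
    have "i \<le> k \<longleftrightarrow> i \<le> k - 1 \<or> i = k" for i using assms by auto
    then show ?thesis using assms by auto
  qed
  then show ?thesis using assms by (simp add: des_def)
qed

text \<open>The variable marks the number \<open>m\<close> of letter couples. The companion
  \<open>enriched_fps'\<close> has the additional even letter \<open>2 * m\<close>, since the
  recursion enlarges the alphabet by single letters.\<close>

definition enriched_fps :: "(nat \<Rightarrow> nat) \<Rightarrow> nat \<Rightarrow> 'a::idom fps" where
  "enriched_fps p n = Abs_fps (\<lambda>m. of_nat (card (tie_chains (ties odd p) n (2 * m))))"

definition enriched_fps' :: "(nat \<Rightarrow> nat) \<Rightarrow> nat \<Rightarrow> 'a::idom fps" where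
  "enriched_fps' p n = Abs_fps (\<lambda>m. of_nat (card (tie_chains (ties odd p) n (2 * m + 1))))"

text \<open>At an ascent an odd top letter may tie and an even one may not, so in both cases the
  shorter word is over an alphabet of even size.\<close>

lemma enriched_fps_ascent:
  assumes "k \<ge> 1" "p k < p (Suc k)"
  shows "enriched_fps' p (Suc k) = enriched_fps p (Suc k) + (enriched_fps p k :: 'a::idom fps)"
    and "enriched_fps p (Suc k) = fps_X * enriched_fps' p (Suc k) + (enriched_fps p k :: 'a fps)"
proof -
  show "enriched_fps' p (Suc k) = enriched_fps p (Suc k) + (enriched_fps p k :: 'a fps)"
    using assms
    by (intro fps_ext) (simp add: enriched_fps_def enriched_fps'_def card_tie_chains_Suc_Suc ties_def)
  have k: "k = Suc (k - 1)" using assms by simp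
  have "enriched_fps p (Suc k) $ m = (fps_X * enriched_fps' p (Suc k) + (enriched_fps p k :: 'a fps)) $ m"
    for m
  proof (cases m)
    case 0
    \<comment> \<open>In the constant coefficient \<open>k \<ge> 1\<close> matters: a nonempty word
      needs a letter.\<close>
    have "tie_chains (ties odd p) k 0 = {}" using tie_chains_Suc_0 k by metis
    then show ?thesis using 0 by (simp add: enriched_fps_def tie_chains_Suc_0)
  next
    case (Suc r)
    then show ?thesis using assms
      by (simp add: enriched_fps_def enriched_fps'_def card_tie_chains_Suc_Suc ties_def)
  qed
  then show "enriched_fps p (Suc k) = fps_X * enriched_fps' p (Suc k) + (enriched_fps p k :: 'a fps)"
    by (rule fps_ext)
qed

text \<open>The first position behaves as if it were preceded by a descent.\<close>

lemma enriched_fps_descent: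
  assumes "k = 0 \<or> p (Suc k) < p k"
  shows "enriched_fps' p (Suc k) = enriched_fps p (Suc k) + (enriched_fps' p k :: 'a::idom fps)"
    and "enriched_fps p (Suc k) = fps_X * (enriched_fps' p (Suc k) + (enriched_fps' p k :: 'a fps))"
proof -
  \<comment> \<open>At a descent the letter \<open>2 * m\<close> may tie and the next one may not,
    so the shorter word always uses \<open>2 * m + 1\<close> letters. For \<open>k = 0\<close> it is
    empty and the bound is immaterial.\<close>
  have even: "card (tie_chains (ties odd p) k (if ties odd p k (2 * m) then Suc (2 * m) else 2 * m)) =
    card (tie_chains (ties odd p) k (Suc (2 * m)))" for m
    using assms by (cases "k = 0") (auto simp: tie_chains_0 ties_def)
  have odd: "card (tie_chains (ties odd p) k
      (if ties odd p k (Suc (2 * m)) then Suc (Suc (2 * m)) else Suc (2 * m))) =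
    card (tie_chains (ties odd p) k (Suc (2 * m)))" for m
    using assms by (cases "k = 0") (auto simp: tie_chains_0 ties_def)
  show "enriched_fps' p (Suc k) = enriched_fps p (Suc k) + (enriched_fps' p k :: 'a fps)"
    by (intro fps_ext) (simp add: enriched_fps_def enriched_fps'_def card_tie_chains_Suc_Suc even)
  have "enriched_fps p (Suc k) $ m =
    (fps_X * (enriched_fps' p (Suc k) + (enriched_fps' p k :: 'a fps))) $ m" for m
    by (cases m)
      (simp_all add: enriched_fps_def enriched_fps'_def tie_chains_Suc_0 card_tie_chains_Suc_Suc odd)
  then show "enriched_fps p (Suc k) = fps_X * (enriched_fps' p (Suc k) + (enriched_fps' p k :: 'a fps))"
    by (rule fps_ext)
qed

text \<open>Eliminating \<open>enriched_fps'\<close> shows that an ascent contributes (1 + t)/(1 -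
  t). The second relation expresses \<open>enriched_fps'\<close>, which a following descent takes as
  input.\<close>

lemma enriched_fps_step_ascent:
  assumes "k \<ge> 1" "p k < p (Suc k)"
  shows "(1 - fps_X) * enriched_fps p (Suc k) = (1 + fps_X) * (enriched_fps p k :: 'a::idom fps)"
    and "(1 + fps_X) * enriched_fps' p (Suc k) = 2 * (enriched_fps p (Suc k) :: 'a fps)"
proof -
  note rec = enriched_fps_ascent[OF assms, where 'a = 'a]
  show F: "(1 - fps_X) * enriched_fps p (Suc k) = (1 + fps_X) * (enriched_fps p k :: 'a fps)"
    using rec by algebra
  have "(1 - fps_X) * ((1 + fps_X) * enriched_fps' p (Suc k)) =
      (1 - fps_X) * (2 * (enriched_fps p (Suc k) :: 'a fps))"
    using rec by algebra
  then show "(1 + fps_X) * enriched_fps' p (Suc k) = 2 * (enriched_fps p (Suc k) :: 'a fps)"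
    using one_minus_fps_X_neq_0 by (metis mult_left_cancel)
qed

text \<open>Substituting the relation known at \<open>k\<close> for \<open>enriched_fps' p k\<close>
  gives the factor (1 + t)/(1 - t) after a descent or at the start of the permutation, and a further
  4t/(1 + t)^2 after an ascent, that is, at a peak.\<close>

lemma enriched_fps_step_descent:
  assumes "k = 0 \<or> p (Suc k) < p k"
  shows "(1 - fps_X) * enriched_fps p (Suc k) = 2 * fps_X * (enriched_fps' p k :: 'a::idom fps)"
    and "(1 + fps_X) * enriched_fps p (Suc k) = 2 * fps_X * (enriched_fps' p (Suc k) :: 'a fps)"
proof -
  note rec = enriched_fps_descent[OF assms, where 'a = 'a]
  show F: "(1 - fps_X) * enriched_fps p (Suc k) = 2 * fps_X * (enriched_fps' p k :: 'a fps)"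
    using rec by algebra
  have "(1 - fps_X) * ((1 + fps_X) * enriched_fps p (Suc k)) =
      (1 - fps_X) * (2 * fps_X * (enriched_fps' p (Suc k) :: 'a fps))"
    using rec by algebra
  then show "(1 + fps_X) * enriched_fps p (Suc k) = 2 * fps_X * (enriched_fps' p (Suc k) :: 'a fps)"
    using one_minus_fps_X_neq_0 by (metis mult_left_cancel)
qed

section \<open>Closed forms of the series for peaks and for descents\<close>

lemma Abs_fps_1_times_one_minus_fps_X: "(1 - fps_X) * Abs_fps (\<lambda>_. 1) = (1 :: 'a::comm_ring_1 fps)"
proof (rule fps_ext)
  fix n
  show "((1 - fps_X) * Abs_fps (\<lambda>_. 1)) $ n = (1 :: 'a fps) $ n"
    by (cases n) (simp_all add: algebra_simps)
qed

lemma enriched_fps_pk: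
  assumes inj: "inj p" and n: "n \<ge> 1"
  shows "2 * enriched_fps p n * (1 - fps_X) ^ (n + 1) * (1 + fps_X) ^ (2 * (pk n p + 1)) =
    (1 + fps_X) ^ (n + 1) * (4 * fps_X :: 'a::idom fps) ^ (pk n p + 1)"
proof -
  let ?F = "enriched_fps p :: nat \<Rightarrow> 'a fps" and ?G = "enriched_fps' p :: nat \<Rightarrow> 'a fps"
  \<comment> \<open>The claim, with denominators cleared, is strengthened by a relation between the
    two series that records the type of the last step; \<open>n = 1\<close> counts as a
    descent.\<close>
  have "2 * ?F n * (1 - fps_X) ^ (n + 1) * (1 + fps_X) ^ (2 * (pk n p + 1)) =
      (1 + fps_X) ^ (n + 1) * (4 * fps_X) ^ (pk n p + 1) \<and>
    (if n \<ge> 2 \<and> p (n - 1) < p n then (1 + fps_X) * ?G n = 2 * ?F n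
     else (1 + fps_X) * ?F n = 2 * fps_X * ?G n)"
    using n
  proof (induction n rule: nat_induct_at_least)
    case base
    have G0: "(1 - fps_X) * ?G 0 = 1"
      using Abs_fps_1_times_one_minus_fps_X by (simp add: enriched_fps'_def tie_chains_0)
    have F1: "(1 - fps_X) * ?F 1 = 2 * fps_X * ?G 0" "(1 + fps_X) * ?F 1 = 2 * fps_X * ?G 1"
      using enriched_fps_step_descent[of 0 p, where 'a = 'a] by simp_all
    have "2 * ?F 1 * (1 - fps_X) ^ 2 * (1 + fps_X) ^ 2 = (1 + fps_X) ^ 2 * (4 * fps_X)"
      using F1(1) G0 by algebra
    moreover have "pk 1 p = 0" by (simp add: pk_def)
    ultimately show ?case using F1(2) by (simp add: numeral_2_eq_2)
  next
    case (Suc k)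
    define a where "a = (1 - fps_X :: 'a fps) ^ (k + 1)"
    define b where "b = (1 + fps_X :: 'a fps) ^ (2 * (pk k p + 1))"
    define c where "c = (1 + fps_X :: 'a fps) ^ (k + 1)"
    define d where "d = (4 * fps_X :: 'a fps) ^ (pk k p + 1)"
    have IH: "2 * ?F k * a * b = c * d" using Suc.IH by (simp add: a_def b_def c_def d_def)
    have neq: "p k \<noteq> p (Suc k)" using inj by (simp add: inj_eq)
    \<comment> \<open>All steps that create no peak multiply the series by the same factor, so they
      are treated together.\<close>
    have same: ?case if pk: "pk (Suc k) p = pk k p" and F: "(1 - fps_X) * ?F (Suc k) = (1 + fps_X) * ?F k"
      and rel: "if p k < p (Suc k) then (1 + fps_X) * ?G (Suc k) = 2 * ?F (Suc k)
        else (1 + fps_X) * ?F (Suc k) = 2 * fps_X * ?G (Suc k)"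
    proof -
      have "2 * ?F (Suc k) * ((1 - fps_X) * a) * b = ((1 + fps_X) * c) * d"
        using IH F by algebra
      then show ?thesis using rel pk Suc.hyps by (simp add: a_def b_def c_def d_def)
    qed
    show ?case
    proof (cases "p k < p (Suc k)")
      case True
      then show ?thesis using enriched_fps_step_ascent[of k p, where 'a = 'a] Suc.hyps
        by (intro same) (simp_all add: pk_Suc)
    next
      case False
      then have desc: "p (Suc k) < p k" using neq by simp
      note step = enriched_fps_step_descent[OF disjI2[OF desc], where 'a = 'a]
      show ?thesis
      proof (cases "k \<ge> 2 \<and> p (k - 1) < p k")
        case True
        then have pk: "pk (Suc k) p = Suc (pk k p)" using desc Suc.hyps by (simp add: pk_Suc)
        have rel: "(1 + fps_X) * ?G k = 2 * ?F k" using Suc.IH True by simp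
        have "2 * ?F (Suc k) * ((1 - fps_X) * a) * ((1 + fps_X) * ((1 + fps_X) * b)) =
            ((1 + fps_X) * c) * ((4 * fps_X) * d)"
          using IH step(1) rel by algebra
        then show ?thesis using step(2) desc pk by (simp add: a_def b_def c_def d_def)
      next
        case False
        then have pk: "pk (Suc k) p = pk k p" using Suc.hyps by (auto simp: pk_Suc)
        have rel: "(1 + fps_X) * ?F k = 2 * fps_X * ?G k" using Suc.IH False by simp
        show ?thesis using desc step rel by (intro same pk) simp_all
      qed
    qed
  qed
  then show ?thesis by simp
qed

text \<open>With all letters positive, ties occur along ascents only: an ascent contributes 1/(1 -
  t), while a descent and the first position contribute t/(1 - t). The empty word starts with 1/(1 -
  t).\<close>

lemma fps_card_tie_chains_des:
  assumes inj: "inj p" and n: "n \<ge> 1"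
  shows "(1 - fps_X) ^ (n + 1) * Abs_fps (\<lambda>m. of_nat (card (tie_chains (ties (\<lambda>_. True) p) n m))) =
    (fps_X ^ (des n p + 1) :: 'a::idom fps)"
proof -
  define E where "E k = (Abs_fps (\<lambda>m. of_nat (card (tie_chains (ties (\<lambda>_. True) p) k m))) :: 'a fps)" for k
  have asc: "(1 - fps_X) * E (Suc k) = E k" if "k \<ge> 1" "p k < p (Suc k)" for k
  proof -
    have k: "k = Suc (k - 1)" using that by simp
    have "E (Suc k) $ m = (fps_X * E (Suc k) + E k) $ m" for m
    proof (cases m)
      case 0
      have "tie_chains (ties (\<lambda>_. True) p) k 0 = {}" using tie_chains_Suc_0 k by metis
      then show ?thesis using 0 by (simp add: E_def tie_chains_Suc_0)
    next
      case (Suc r)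
      then show ?thesis using that by (simp add: E_def card_tie_chains_Suc_Suc ties_def)
    qed
    then have "E (Suc k) = fps_X * E (Suc k) + E k" by (rule fps_ext)
    then show ?thesis by algebra
  qed
  have desc: "(1 - fps_X) * E (Suc k) = fps_X * E k" if "k = 0 \<or> p (Suc k) < p k" for k
  proof -
    have tie: "card (tie_chains (ties (\<lambda>_. True) p) k (if ties (\<lambda>_. True) p k m then Suc m else m)) =
      card (tie_chains (ties (\<lambda>_. True) p) k m)" for m
      using that by (cases "k = 0") (auto simp: tie_chains_0 ties_def)
    have "E (Suc k) $ m = (fps_X * E (Suc k) + fps_X * E k) $ m" for m
      by (cases m) (simp_all add: E_def tie_chains_Suc_0 card_tie_chains_Suc_Suc tie)
    then have "E (Suc k) = fps_X * E (Suc k) + fps_X * E k" by (rule fps_ext)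
    then show ?thesis by algebra
  qed
  have "(1 - fps_X) ^ (n + 1) * E n = fps_X ^ (des n p + 1)"
    using n
  proof (induction n rule: nat_induct_at_least)
    case base
    have "(1 - fps_X) * E 0 = 1"
      using Abs_fps_1_times_one_minus_fps_X by (simp add: E_def tie_chains_0)
    moreover have "(1 - fps_X) * E 1 = fps_X * E 0" using desc[of 0] by simp
    ultimately have "(1 - fps_X) * ((1 - fps_X) * E 1) = fps_X" by algebra
    then show ?case by (simp add: des_def mult.assoc)
  next
    case (Suc k)
    have neq: "p k \<noteq> p (Suc k)" using inj by (simp add: inj_eq)
    have eq: "(1 - fps_X) ^ (Suc k + 1) * E (Suc k) = (1 - fps_X) ^ (k + 1) * ((1 - fps_X) * E (Suc k))"
      by (simp add: mult_ac)
    show ?case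
    proof (cases "p k < p (Suc k)")
      case True
      then show ?thesis unfolding eq using asc[OF Suc.hyps True] Suc.IH Suc.hyps by (simp add: des_Suc)
    next
      case False
      then have lt: "p (Suc k) < p k" using neq by simp
      have "(1 - fps_X) ^ (k + 1) * (fps_X * E k) = fps_X * ((1 - fps_X) ^ (k + 1) * E k)"
        by (rule mult.left_commute)
      then show ?thesis
        unfolding eq desc[OF disjI2[OF lt]] Suc.IH using lt Suc.hyps by (simp add: des_Suc)
    qed
  qed
  then show ?thesis by (simp add: E_def)
qed

text \<open>The classical series for Eulerian polynomials: summing the descent series over all
  permutations counts all words of length \<open>n\<close> over \<open>i\<close> letters. For
  \<open>n = 0\<close> it rests on the conventions for the zeroth polynomial and for 0 to the power
  0.\<close>

lemma eulerian_fps_X: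
  "eulerian n (fps_X :: 'a::idom fps) = (1 - fps_X) ^ (n + 1) * Abs_fps (\<lambda>i. of_nat i ^ n)"
proof (cases "n = 0")
  case True
  then show ?thesis using Abs_fps_1_times_one_minus_fps_X by (simp add: eulerian_def)
next
  case False
  let ?C = "\<lambda>p m. of_nat (card (tie_chains (ties (\<lambda>_. True) p) n m)) :: 'a"
  have "eulerian n (fps_X :: 'a fps) = (\<Sum>p | p permutes {1..n}. (1 - fps_X) ^ (n + 1) * Abs_fps (?C p))"
    using False fps_card_tie_chains_des[OF permutes_inj, of _ _ n, where 'a = 'a]
    by (simp add: eulerian_def)
  also have "\<dots> = (1 - fps_X) ^ (n + 1) * (\<Sum>p | p permutes {1..n}. Abs_fps (?C p))"
    by (simp only: sum_distrib_left)
  also have "(\<Sum>p | p permutes {1..n}. Abs_fps (?C p)) = Abs_fps (\<lambda>i. of_nat i ^ n)"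
    by (rule fps_ext)
      (simp add: fps_sum_nth of_nat_sum[symmetric] sum_card_tie_chains_words[simplified] del: of_nat_sum)
  finally show ?thesis .
qed

section \<open>Permutations with odd cycles\<close>

text \<open>The composition sends \<open>z\<close> to \<open>x\<close> and \<open>x\<close> to
  \<open>p z\<close>: it inserts \<open>x\<close> into the cycle of \<open>z\<close>, right after
  \<open>z\<close>, and leaves the other cycles alone.\<close>

lemma orbit_compose_transpose:
  assumes p: "p permutes S" and S: "finite S" and x: "x \<notin> S" and z: "z \<in> S"
  shows "orbit (p \<circ> transpose x z) ` insert x S =
    insert (insert x (orbit p z)) (orbit p ` S - {orbit p z})"
    and "orbit (p \<circ> transpose x z) z = insert x (orbit p z)"
proof -
  define q where "q = p \<circ> transpose x z"
  have px: "p x = x" using p x by (rule permutes_not_in)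
  have zx: "z \<noteq> x" using x z by auto
  have qz: "q z = x" and qx: "q x = p z" using px by (simp_all add: q_def)
  have q: "q w = p w" if "w \<noteq> x" "w \<noteq> z" for w
    using that by (simp add: q_def transpose_apply_other)
  have perm_p: "permutation p" using p S unfolding permutation_permutes by blast
  have qT: "q permutes insert x S"
    unfolding q_def using permutes_compose[OF permutes_swap_id[of x "insert x S" z] permutes_subset[OF p]] z
    by blast
  have perm_q: "permutation q" using qT S unfolding permutation_permutes by blast
  have self_p: "w \<in> orbit p w" for w using permutation_self_in_orbit[OF perm_p] .
  have self_q: "w \<in> orbit q w" for w using permutation_self_in_orbit[OF perm_q] .
  have sub_S: "orbit p w \<subseteq> S" if "w \<in> S" for w
    using permutes_orbit_subset[OF p that] .
  have "w \<in> orbit q z" if "w \<in> orbit p z" for w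
    using that
  proof induction
    case base
    have "q (q z) \<in> orbit q z" by (intro orbit.intros)
    then show ?case by (simp add: qz qx)
  next
    case (step w)
    have "w \<noteq> x" using step.hyps sub_S[OF z] x by blast
    show ?case
    proof (cases "w = z")
      case True
      have "q (q z) \<in> orbit q z" by (intro orbit.intros)
      then show ?thesis using True by (simp add: qz qx)
    next
      case False
      then show ?thesis using orbit.step[OF step.IH] q[OF \<open>w \<noteq> x\<close>] by simp
    qed
  qed
  moreover have "x \<in> orbit q z" using orbit.base[of q z] qz by simp
  moreover have "w \<in> insert x (orbit p z)" if "w \<in> orbit q z" for w
    using that
  proof induction
    case (step w)
    show ?case
    proof (cases "w = x \<or> w = z")
      case True
      then show ?thesis using qx qz orbit.base[of p z] by auto
    next
      case False
      then have "w \<in> orbit p z" using step.IH by simp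
      then show ?thesis using orbit.step[of w p z] q False by simp
    qed
  qed (simp add: qz)
  ultimately have orb_z: "orbit q z = insert x (orbit p z)" by blast
  then show "orbit (p \<circ> transpose x z) z = insert x (orbit p z)" by (simp add: q_def)
  have eq_q: "orbit q w = orbit q z" if "w \<in> orbit q z" for w
    using orbit_cyclic_eq3[OF cyclic_on_orbit'[OF perm_q] that] .
  have eq_p: "orbit p w = orbit p z" if "w \<in> orbit p z" for w
    using orbit_cyclic_eq3[OF cyclic_on_orbit'[OF perm_p] that] .
  \<comment> \<open>A cycle other than that of \<open>z\<close> contains neither \<open>x\<close>
    nor \<open>z\<close>, and \<open>q\<close> agrees with \<open>p\<close> elsewhere.\<close>
  have orb_other: "orbit q w = orbit p w" if w: "w \<in> S" "w \<notin> orbit p z" for w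
  proof -
    have ne: "v \<noteq> x" "v \<noteq> z" if "v \<in> orbit p w" for v
    proof -
      show "v \<noteq> x" using that sub_S[OF w(1)] x by blast
      show "v \<noteq> z"
      proof
        assume "v = z"
        then have "w \<in> orbit p z" using orbit_swap[OF self_p[of w]] that by blast
        with w show False by simp
      qed
    qed
    have "v \<in> orbit q w" if "v \<in> orbit p w" for v
      using that
    proof induction
      case base
      show ?case using orbit.base[of q w] q[OF ne[OF self_p]] by simp
    next
      case (step v)
      then show ?case using orbit.step[of v q w] q[OF ne[OF step.hyps]] by simp
    qed
    moreover have "v \<in> orbit p w" if "v \<in> orbit q w" for v
      using that
    proof induction
      case base
      show ?case using orbit.base[of p w] q[OF ne[OF self_p]] by simp
    next
      case (step v)
      then show ?case using orbit.step[of v p w] q[OF ne[OF step.IH]] by simp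
    qed
    ultimately show ?thesis by blast
  qed
  have "orbit q ` insert x S = insert (insert x (orbit p z)) (orbit p ` S - {orbit p z})"
  proof (intro equalityI subsetI)
    fix c assume "c \<in> orbit q ` insert x S"
    then obtain w where w: "w \<in> insert x S" "c = orbit q w" by blast
    show "c \<in> insert (insert x (orbit p z)) (orbit p ` S - {orbit p z})"
    proof (cases "w \<in> orbit q z")
      case True
      then show ?thesis using eq_q orb_z w by simp
    next
      case False
      then have "w \<in> S" "w \<notin> orbit p z" using w orb_z by auto
      then have "c = orbit p w" using orb_other w by simp
      moreover have "orbit p w \<noteq> orbit p z" using self_p[of w] \<open>w \<notin> orbit p z\<close> by blast
      ultimately show ?thesis using \<open>w \<in> S\<close> by blast
    qed
  next
    fix c assume "c \<in> insert (insert x (orbit p z)) (orbit p ` S - {orbit p z})"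
    then consider "c = orbit q z" | w where "w \<in> S" "c = orbit p w" "c \<noteq> orbit p z"
      using orb_z by auto
    then show "c \<in> orbit q ` insert x S"
    proof cases
      case 1
      then show ?thesis using z by blast
    next
      case 2
      then have "w \<notin> orbit p z" using eq_p by blast
      then show ?thesis using 2 orb_other by blast
    qed
  qed
  then show "orbit (p \<circ> transpose x z) ` insert x S =
    insert (insert x (orbit p z)) (orbit p ` S - {orbit p z})" by (simp add: q_def)
qed

text \<open>General sets \<open>S\<close> are needed because the recursion deletes arbitrary
  elements. The value 0 for even cycles allows sums over all permutations.\<close>

definition odd_cycle_weight :: "'b::comm_semiring_1 \<Rightarrow> 'a set \<Rightarrow> ('a \<Rightarrow> 'a) \<Rightarrow> 'b" where
  "odd_cycle_weight y S p =
     (if \<forall>c\<in>orbit p ` S. odd (card c) then y ^ card (orbit p ` S) else 0)"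

lemma odd_cycle_weight_insert_fixpoint:
  assumes p: "p permutes S" and S: "finite S" and x: "x \<notin> S"
  shows "odd_cycle_weight y (insert x S) p = y * odd_cycle_weight y S p"
proof -
  have "orbit p x = {x}"
    using permutes_not_in[OF p x] by (simp add: orbit_eq_singleton_iff)
  moreover have "{x} \<notin> orbit p ` S"
    using permutes_orbit_subset[OF p] x by blast
  ultimately show ?thesis using S by (simp add: odd_cycle_weight_def)
qed

text \<open>The cycle of \<open>z\<close> now runs from \<open>z\<close> through \<open>x\<close>
  and \<open>m\<close> to \<open>p z\<close>. It grows by two elements, so the number of cycles and
  all parities are kept.\<close>

lemma odd_cycle_weight_insert_two:
  assumes p: "p permutes S" and S: "finite S" and z: "z \<in> S"
    and x: "x \<notin> insert m S" and m: "m \<notin> S"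
  shows "odd_cycle_weight y (insert x (insert m S)) (p \<circ> transpose m z \<circ> transpose x z) =
    odd_cycle_weight y S p"
proof -
  let ?q = "p \<circ> transpose m z" and ?O = "orbit p z"
  have q: "?q permutes insert m S"
    using permutes_compose[OF permutes_swap_id[of m "insert m S" z] permutes_subset[OF p]] z by blast
  have sub: "c \<subseteq> S" if "c \<in> orbit p ` S" for c
    using permutes_orbit_subset[OF p] that by blast
  have O: "?O \<in> orbit p ` S" using z by blast
  have finO: "finite ?O" using sub[OF O] S finite_subset by blast
  have "orbit (?q \<circ> transpose x z) ` insert x (insert m S) =
    insert (insert x (insert m ?O)) (insert (insert m ?O) (orbit p ` S - {?O}) - {insert m ?O})"
    using orbit_compose_transpose[OF q _ x, of z] orbit_compose_transpose[OF p S m z] S z by simp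
  also have "insert m ?O \<notin> orbit p ` S" using sub m by blast
  then have "insert (insert m ?O) (orbit p ` S - {?O}) - {insert m ?O} = orbit p ` S - {?O}"
    by blast
  finally have eq: "orbit (?q \<circ> transpose x z) ` insert x (insert m S) =
    insert (insert x (insert m ?O)) (orbit p ` S - {?O})" .
  have new: "insert x (insert m ?O) \<notin> orbit p ` S - {?O}" using sub m by blast
  have "x \<notin> ?O" "m \<notin> ?O" using sub[OF O] x m by auto
  then have "card (insert x (insert m ?O)) = Suc (Suc (card ?O))"
    using x finO by simp
  then have "(\<forall>c\<in>insert (insert x (insert m ?O)) (orbit p ` S - {?O}). odd (card c)) \<longleftrightarrow>
    (\<forall>c\<in>orbit p ` S. odd (card c))"
    using O by auto
  moreover have "card (insert (insert x (insert m ?O)) (orbit p ` S - {?O})) = card (orbit p ` S)"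
    using new O S by (simp add: card_Suc_Diff1 del: card_Diff_insert)
  ultimately show ?thesis unfolding odd_cycle_weight_def eq by simp
qed

lemma odd_cycle_weight_two_cycle:
  assumes "p x \<noteq> x" "p (p x) = x" "x \<in> S"
  shows "odd_cycle_weight y S p = 0"
proof -
  have "w = p x \<or> w = x" if "w \<in> orbit p x" for w
    using that by induction (use assms in auto)
  moreover have "p x \<in> orbit p x" "p (p x) \<in> orbit p x" by (intro orbit.intros)+
  ultimately have "orbit p x = {p x, x}" using assms by auto
  then have "even (card (orbit p x))" using assms by simp
  then show ?thesis using assms(3) by (auto simp: odd_cycle_weight_def)
qed

text \<open>The element \<open>x\<close> is a fixed point, lies in a cycle of length two, which has
  weight 0, or lies in a longer cycle. In the last case \<open>x\<close> and its image
  \<open>m\<close> are deleted, and the predecessor \<open>z\<close> of \<open>x\<close> is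
  remembered.\<close>

lemma sum_odd_cycle_weight_insert:
  assumes S: "finite S" and x: "x \<notin> S"
  shows "(\<Sum>p | p permutes insert x S. odd_cycle_weight y (insert x S) p) =
    y * (\<Sum>p | p permutes S. odd_cycle_weight y S p) +
    (\<Sum>m\<in>S. \<Sum>z\<in>S - {m}. \<Sum>p | p permutes S - {m}. odd_cycle_weight y (S - {m}) p)"
proof -
  let ?T = "insert x S"
  let ?w = "odd_cycle_weight y ?T"
  let ?A = "{p. p permutes S}"
  let ?B = "{p. p permutes ?T \<and> p x \<noteq> x \<and> p (p x) = x}"
  let ?C = "{p. p permutes ?T \<and> p x \<noteq> x \<and> p (p x) \<noteq> x}"
  let ?D = "SIGMA m:S. SIGMA z:S - {m}. {p. p permutes S - {m}}"
  have fin: "finite {p. p permutes ?T}" using S by (simp add: finite_permutations)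
  have A: "?A = {p. p permutes ?T \<and> p x = x}"
  proof (intro equalityI subsetI CollectI)
    fix p assume "p \<in> ?A"
    then show "p permutes ?T \<and> p x = x"
      using permutes_subset[of p S ?T] permutes_not_in[of p S x] x by auto
  next
    fix p assume "p \<in> {p. p permutes ?T \<and> p x = x}"
    then show "p permutes S" by (auto intro: permutes_superset)
  qed
  have split: "{p. p permutes ?T} = ?A \<union> (?B \<union> ?C)" unfolding A by blast
  have "?A \<inter> (?B \<union> ?C) = {}" "?B \<inter> ?C = {}" unfolding A by blast+
  moreover have "finite ?A" "finite ?B" "finite ?C"
    using fin unfolding A by (blast intro: rev_finite_subset)+
  ultimately have "sum ?w {p. p permutes ?T} = sum ?w ?A + (sum ?w ?B + sum ?w ?C)"
    unfolding split by (simp only: sum.union_disjoint finite_UnI)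
  also have "sum ?w ?B = 0"
    by (intro sum.neutral ballI odd_cycle_weight_two_cycle[of _ x]) auto
  also have "sum ?w ?A = y * (\<Sum>p | p permutes S. odd_cycle_weight y S p)"
    unfolding sum_distrib_left
    by (intro sum.cong refl odd_cycle_weight_insert_fixpoint[OF _ S x]) simp
  also have "sum ?w ?C = (\<Sum>(m, z, p)\<in>?D. odd_cycle_weight y (S - {m}) p)"
  proof (rule sum.reindex_bij_witness[where
        j = "\<lambda>q. (q x, inv q x, q \<circ> transpose x (inv q x) \<circ> transpose (q x) (inv q x))" and
        i = "\<lambda>(m, z, p). p \<circ> transpose m z \<circ> transpose x z"])
    fix q assume "q \<in> ?C"
    then have q: "q permutes ?T" and ne: "q x \<noteq> x" "q (q x) \<noteq> x" by auto
    define m z where "m = q x" and "z = inv q x"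
    define p where "p = q \<circ> transpose x z \<circ> transpose m z"
    have qz: "q z = x" using permutes_inverses(1)[OF q] by (simp add: z_def)
    have "z \<in> ?T" using permutes_in_image[OF permutes_inv[OF q], of x] by (simp add: z_def)
    moreover have "m \<in> ?T" using permutes_in_image[OF q, of x] by (simp add: m_def)
    \<comment> \<open>Here \<open>z \<noteq> m\<close> expresses that the cycle of \<open>x\<close>
      has length greater than two: \<open>q\<close> sends \<open>z\<close> to \<open>x\<close> but
      not \<open>m\<close>.\<close>
    moreover have "z \<noteq> x" "z \<noteq> m" "m \<noteq> x" using qz ne by (auto simp: m_def)
    ultimately have mz: "m \<in> S" "z \<in> S - {m}" by auto
    have "transpose x z permutes ?T" "transpose m z permutes ?T"
      using mz by (auto intro!: permutes_swap_id)
    then have "p permutes ?T" unfolding p_def using q by (intro permutes_compose)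
    moreover have "p m = m" "p x = x"
      using \<open>z \<noteq> x\<close> \<open>z \<noteq> m\<close> \<open>m \<noteq> x\<close> qz
      by (auto simp: p_def m_def transpose_def)
    ultimately have p: "p permutes S - {m}"
      by (elim permutes_superset) auto
    show "(q x, inv q x, q \<circ> transpose x (inv q x) \<circ> transpose (q x) (inv q x)) \<in> ?D"
      using mz p by (simp add: m_def z_def p_def)
    have inv: "p \<circ> transpose m z \<circ> transpose x z = q"
      by (simp add: p_def fun_eq_iff)
    then show "(case (q x, inv q x, q \<circ> transpose x (inv q x) \<circ> transpose (q x) (inv q x)) of
        (m, z, p) \<Rightarrow> p \<circ> transpose m z \<circ> transpose x z) = q"
      by (simp add: m_def z_def p_def)
    have "insert x (insert m (S - {m})) = ?T" using mz by blast
    then have "?w q = odd_cycle_weight y (S - {m}) p"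
      using odd_cycle_weight_insert_two[OF p _ mz(2), of x m y] S x mz(1) inv by auto
    then show "(case (q x, inv q x, q \<circ> transpose x (inv q x) \<circ> transpose (q x) (inv q x)) of
        (m, z, p) \<Rightarrow> odd_cycle_weight y (S - {m}) p) = ?w q"
      by (simp add: m_def z_def p_def)
  next
    fix t assume "t \<in> ?D"
    then obtain m z p where t: "t = (m, z, p)" and mz: "m \<in> S" "z \<in> S" "z \<noteq> m"
      and p: "p permutes S - {m}" by auto
    define q where "q = p \<circ> transpose m z \<circ> transpose x z"
    have xz: "x \<noteq> z" "x \<noteq> m" using x mz by auto
    have fix_p: "p x = x" "p m = m" using permutes_not_in[OF p] x by auto
    have pT: "p permutes ?T" using p by (rule permutes_subset) auto
    have "transpose x z permutes ?T" "transpose m z permutes ?T"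
      using mz by (auto intro!: permutes_swap_id)
    then have q: "q permutes ?T" unfolding q_def using pT by (intro permutes_compose)
    have qx: "q x = m" and qz: "q z = x" and qm: "q m = p z"
      using xz mz fix_p by (auto simp: q_def transpose_def)
    have "p z \<noteq> x" using fix_p permutes_inj[OF p] xz by (metis injD)
    then show "(case t of (m, z, p) \<Rightarrow> p \<circ> transpose m z \<circ> transpose x z) \<in> ?C"
      using q qx qm xz unfolding t q_def by simp
    have "inv q x = z" using permutes_inv_eq[OF q] qz by simp
    then show "((case t of (m, z, p) \<Rightarrow> p \<circ> transpose m z \<circ> transpose x z) x,
        inv (case t of (m, z, p) \<Rightarrow> p \<circ> transpose m z \<circ> transpose x z) x,
        (case t of (m, z, p) \<Rightarrow> p \<circ> transpose m z \<circ> transpose x z) \<circ>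
        transpose x (inv (case t of (m, z, p) \<Rightarrow> p \<circ> transpose m z \<circ> transpose x z) x) \<circ>
        transpose ((case t of (m, z, p) \<Rightarrow> p \<circ> transpose m z \<circ> transpose x z) x)
         (inv (case t of (m, z, p) \<Rightarrow> p \<circ> transpose m z \<circ> transpose x z) x)) = t"
      using qx unfolding t prod.case q_def[symmetric] by (simp add: q_def fun_eq_iff)
  qed
  also have "(\<Sum>(m, z, p)\<in>?D. odd_cycle_weight y (S - {m}) p) =
    (\<Sum>m\<in>S. \<Sum>z\<in>S - {m}. \<Sum>p | p permutes S - {m}. odd_cycle_weight y (S - {m}) p)"
  proof -
    have "(\<Sum>m\<in>S. \<Sum>z\<in>S - {m}. \<Sum>p | p permutes S - {m}. odd_cycle_weight y (S - {m}) p) =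
      (\<Sum>m\<in>S. \<Sum>(z, p)\<in>(SIGMA z:S - {m}. {p. p permutes S - {m}}). odd_cycle_weight y (S - {m}) p)"
      using S by (intro sum.cong refl sum.Sigma) (auto simp: finite_permutations)
    also have "\<dots> = (\<Sum>(m, z, p)\<in>?D. odd_cycle_weight y (S - {m}) p)"
      using S by (intro sum.Sigma) (auto simp: finite_permutations)
    finally show ?thesis ..
  qed
  finally show ?thesis by (simp only: add_0_left)
qed

text \<open>Deleting elements from odd cycles gives the recurrence that the differential equation
  gives for the coefficients, up to the factorial; the weight per cycle is \<open>2 * N\<close> to
  match the equation.\<close>

lemma sum_odd_cycle_weight:
  fixes N :: nat and T :: "'a set"
  assumes "finite T"
  shows "(\<Sum>p | p permutes T. odd_cycle_weight (of_nat (2 * N)) T p) =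
    fact (card T) * fps_nth (((1 + fps_X) / (1 - fps_X) :: rat fps) ^ N) (card T)"
  using assms
proof (induction "card T" arbitrary: T rule: less_induct)
  case less
  define f where "f = ((1 + fps_X) / (1 - fps_X) :: rat fps) ^ N"
  let ?W = "\<lambda>T :: 'a set. \<Sum>p | p permutes T. odd_cycle_weight (of_nat (2 * N)) T p :: rat"
  note rec = fps_nth_one_plus_X_over_one_minus_X_power_rec[where N = N, folded f_def]
  have W0: "?W {} = 1" by (simp add: odd_cycle_weight_def)
  have "?W T = fact (card T) * f $ card T"
  proof (cases "T = {}")
    case True
    then show ?thesis using W0 rec(1) by simp
  next
    case False
    then obtain x S where T: "T = insert x S" "x \<notin> S" by (meson all_not_in_conv mk_disjoint_insert)
    then have S: "finite S" and cT: "card T = Suc (card S)" using less.prems by auto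
    show ?thesis
    proof (cases "card S")
      case 0
      then show ?thesis using S T sum_odd_cycle_weight_insert[OF S T(2), of "of_nat (2 * N) :: rat"] W0 rec(2)
        by simp
    next
      case (Suc n)
      have IH1: "?W S = fact (n + 1) * f $ (n + 1)"
        using less.hyps[of S, folded f_def] S cT Suc by simp
      have IH2: "?W (S - {m}) = fact n * f $ n" if "m \<in> S" for m
        using less.hyps[of "S - {m}", folded f_def] S cT Suc that by simp
      have "?W T = of_nat (2 * N) * (fact (n + 1) * f $ (n + 1)) +
        (\<Sum>m\<in>S. \<Sum>z\<in>S - {m}. fact n * f $ n)"
        unfolding T(1) sum_odd_cycle_weight_insert[OF S T(2)] IH1 using IH2 by simp
      also have "(\<Sum>m\<in>S. \<Sum>z\<in>S - {m}. fact n * f $ n) = of_nat (n + 1) * of_nat n * (fact n * f $ n)"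
        using Suc S by simp
      also have "of_nat (2 * N) * (fact (n + 1) * f $ (n + 1)) + of_nat (n + 1) * of_nat n * (fact n * f $ n) =
        fact (n + 1) * (2 * of_nat N * f $ (n + 1) + of_nat n * f $ n)"
        by (simp add: algebra_simps)
      also have "\<dots> = fact (n + 1) * (of_nat (n + 2) * f $ (n + 2))"
        by (simp only: rec(3)[of n])
      also have "\<dots> = fact (n + 2) * f $ (n + 2)" by (simp add: algebra_simps)
      finally show ?thesis using cT Suc by simp
    qed
  qed
  then show ?case unfolding f_def .
qed

lemma sum_odd_cycle_count:
  "(\<Sum>k=0..n. of_nat (odd_cycle_count n k) * y ^ k) =
     (\<Sum>p | p permutes {1..n}. odd_cycle_weight y {1..n} p)"
proof -
  let ?Q = "\<lambda>p. \<forall>c\<in>perm_cycles n p. odd (card c)"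
  let ?P = "{p. p permutes {1..n} \<and> ?Q p}"
  have fin: "finite {p. p permutes {1..n}}" by (simp add: finite_permutations)
  then have finP: "finite ?P" by (rule rev_finite_subset) blast
  have "card (perm_cycles n p) \<le> n" for p
    using card_image_le[of "{1..n}" "orbit p"] by (simp add: perm_cycles_def)
  then have img: "(\<lambda>p. card (perm_cycles n p)) ` ?P \<subseteq> {0..n}" by auto
  have "(\<Sum>p | p permutes {1..n}. odd_cycle_weight y {1..n} p) = (\<Sum>p\<in>?P. y ^ card (perm_cycles n p))"
    using fin by (intro sum.mono_neutral_cong_right) (auto simp: odd_cycle_weight_def perm_cycles_def)
  also have "\<dots> = (\<Sum>k=0..n. \<Sum>p\<in>{p \<in> ?P. card (perm_cycles n p) = k}. y ^ card (perm_cycles n p))"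
    by (rule sum.group[symmetric, OF finP _ img]) simp
  also have "\<dots> = (\<Sum>k=0..n. of_nat (odd_cycle_count n k) * y ^ k)"
  proof (rule sum.cong[OF refl])
    fix k
    have "{p \<in> ?P. card (perm_cycles n p) = k} =
      {p. p permutes {1..n} \<and> card (perm_cycles n p) = k \<and> ?Q p}" by blast
    then have "card {p \<in> ?P. card (perm_cycles n p) = k} = odd_cycle_count n k"
      unfolding odd_cycle_count_def by simp
    then show "(\<Sum>p\<in>{p \<in> ?P. card (perm_cycles n p) = k}. y ^ card (perm_cycles n p)) =
      of_nat (odd_cycle_count n k) * y ^ k" by simp
  qed
  finally show ?thesis ..
qed

section \<open>Generating functions in s and t\<close>

lemma fps_fps_divide_eqI:
  fixes f g h :: "rat fps fps"
  assumes "fps_nth (fps_nth g 0) 0 \<noteq> 0" "h * g = f"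
  shows "f / g = h"
proof -
  have "g \<noteq> 0" using assms(1) by auto
  moreover have "f / g * g = h * g" using fps_fps_divide_unit[OF assms(1)] assms(2) by simp
  ultimately show ?thesis by simp
qed

lemma double_series_mult:
  fixes a b :: "nat \<Rightarrow> rat"
  shows "double_series (\<lambda>i j. a i * b j) = Abs_fps (\<lambda>i. fps_const (a i)) * fps_const (Abs_fps b)"
  by (intro fps_ext) (simp add: double_series_def)

lemma double_series_sum:
  fixes a :: "'b \<Rightarrow> nat \<Rightarrow> nat \<Rightarrow> rat"
  shows "(\<Sum>x\<in>A. double_series (a x)) = double_series (\<lambda>i j. \<Sum>x\<in>A. a x i j)"
  by (intro fps_ext) (simp add: double_series_def fps_sum_nth)

lemma of_nat_mult_double_series:
  fixes a :: "nat \<Rightarrow> nat \<Rightarrow> rat"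
  shows "of_nat c * double_series a = double_series (\<lambda>i j. of_nat c * a i j)"
  unfolding fps_of_nat[symmetric] by (intro fps_ext) (simp add: double_series_def)

text \<open>The peak formula concerns the outer variable; the ring homomorphism
  \<open>fps_const\<close> carries it to the inner one.\<close>

lemma enriched_fps_var_t:
  assumes "inj p" "n \<ge> 1"
  shows "2 * fps_const (enriched_fps p n) * (1 - var_t) ^ (n + 1) * (1 + var_t) ^ (2 * (pk n p + 1)) =
    (1 + var_t) ^ (n + 1) * (4 * var_t) ^ (pk n p + 1)"
proof -
  have hom: "fps_const (2 * F * (1 - fps_X) ^ a * (1 + fps_X) ^ b) =
      2 * fps_const F * (1 - var_t) ^ a * (1 + var_t) ^ b"
    "fps_const ((1 + fps_X) ^ a * (4 * fps_X) ^ b) = (1 + var_t) ^ a * (4 * var_t) ^ b"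
    for F :: "rat fps" and a b
    by (simp_all add: numeral_fps_const flip: fps_const_1_eq_1)
  show ?thesis
    using arg_cong[OF enriched_fps_pk[OF assms, where 'a = rat], of fps_const] unfolding hom .
qed

text \<open>Intended values: \<open>A\<close>, \<open>B\<close>, \<open>C\<close>, \<open>E\<close>
  are 1 - s, 1 - t, 1 + s, 1 + t; \<open>S\<close>, \<open>T\<close> are 4s, 4t; \<open>z\<close>,
  \<open>w\<close> are the arguments substituted into the polynomial; \<open>F\<close>,
  \<open>G\<close> are the series of a permutation and of its inverse. Cancelling the nonzero
  \<open>?D\<close> replaces division.\<close>

lemma pk_ipk_term_cancel:
  fixes Q :: "'a::idom"
  assumes Q: "Q * (A * B) = C * E" and z: "z * C\<^sup>2 = S" "w * E\<^sup>2 = T"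
    and F: "2 * F * A ^ N * C ^ (2 * a) = C ^ N * S ^ a" and G: "2 * G * B ^ N * E ^ (2 * b) = E ^ N * T ^ b"
    and nz: "A \<noteq> 0" "B \<noteq> 0" "C \<noteq> 0" "E \<noteq> 0"
  shows "Q ^ N * (z ^ a * w ^ b) = 4 * (F * G)"
proof -
  let ?D = "(A * B) ^ N * (C ^ (2 * a) * E ^ (2 * b))"
  have "Q ^ N * (z ^ a * w ^ b) * ?D = (Q * (A * B)) ^ N * ((z * C\<^sup>2) ^ a * (w * E\<^sup>2) ^ b)"
    by (simp only: power_mult[symmetric] power_mult_distrib mult_ac)
  also have "\<dots> = (C ^ N * S ^ a) * (E ^ N * T ^ b)"
    unfolding Q z by (simp only: power_mult_distrib mult_ac)
  also have "\<dots> = (2 * F * A ^ N * C ^ (2 * a)) * (2 * G * B ^ N * E ^ (2 * b))"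
    unfolding F G ..
  also have "\<dots> = (2 * 2) * (F * G) * ?D"
    by (simp only: power_mult_distrib mult_ac)
  finally show ?thesis using nz by simp
qed

lemma fps_neq_0I: "fps_nth f n \<noteq> 0 \<Longrightarrow> f \<noteq> 0"
  by auto

lemma pk_ipk_series:
  assumes "n \<ge> 1"
  shows "(((1 + var_s) * (1 + var_t)) / ((1 - var_s) * (1 - var_t))) ^ (n + 1) *
      P_pk_ipk n (4 * var_s / (1 + var_s)\<^sup>2) (4 * var_t / (1 + var_t)\<^sup>2) =
    4 * double_series (\<lambda>i j. fps_nth (((1 + fps_X) / (1 - fps_X)) ^ (2 * i * j)) n)"
proof -
  define Q where "Q = ((1 + var_s) * (1 + var_t)) / ((1 - var_s) * (1 - var_t))"
  define z where "z = 4 * var_s / (1 + var_s)\<^sup>2"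
  define w where "w = 4 * var_t / (1 + var_t)\<^sup>2"
  define C where "C p m = card (tie_chains (ties odd p) n (2 * m))" for p m
  have Q: "Q * ((1 - var_s) * (1 - var_t)) = (1 + var_s) * (1 + var_t)"
    unfolding Q_def by (rule fps_fps_divide_unit) simp
  have z: "z * (1 + var_s)\<^sup>2 = 4 * var_s"
    unfolding z_def by (rule fps_fps_divide_unit) (simp add: fps_power_zeroth)
  have w: "w * (1 + var_t)\<^sup>2 = 4 * var_t"
    unfolding w_def by (rule fps_fps_divide_unit) (simp add: fps_power_zeroth)
  have t_neq: "1 - var_t \<noteq> 0" "1 + var_t \<noteq> 0"
    by (rule fps_neq_0I[of _ 0], rule fps_neq_0I[of _ 0], simp)+
  have s_neq: "1 - var_s \<noteq> 0" "1 + var_s \<noteq> 0"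
    by (rule fps_neq_0I[of _ 0], simp)+
  have "Q ^ (n + 1) * (z ^ (pk n p + 1) * w ^ (ipk n p + 1)) =
    4 * double_series (\<lambda>i j. of_nat (C p i) * of_nat (C (inv p) j))"
    if p: "p permutes {1..n}" for p
  proof -
    have inj: "inj p" "inj (inv p)"
      using permutes_inj[OF p] permutes_inj[OF permutes_inv[OF p]] by auto
    have "2 * enriched_fps p n * (1 - var_s) ^ (n + 1) * (1 + var_s) ^ (2 * (pk n p + 1)) =
        (1 + var_s) ^ (n + 1) * (4 * var_s) ^ (pk n p + 1)"
      using enriched_fps_pk[OF inj(1) assms] .
    then have "Q ^ (n + 1) * (z ^ (pk n p + 1) * w ^ (ipk n p + 1)) =
        4 * (enriched_fps p n * fps_const (enriched_fps (inv p) n))"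
      using enriched_fps_var_t[OF inj(2) assms] unfolding ipk_def
      by (intro pk_ipk_term_cancel[OF Q z w] s_neq t_neq)
    also have "(enriched_fps p n :: rat fps fps) * fps_const (enriched_fps (inv p) n) =
        double_series (\<lambda>i j. of_nat (C p i) * of_nat (C (inv p) j))"
      using double_series_mult[of "\<lambda>i. of_nat (C p i)" "\<lambda>j. of_nat (C (inv p) j)"]
      by (simp add: enriched_fps_def C_def fps_of_nat)
    finally show ?thesis .
  qed
  then have "Q ^ (n + 1) * P_pk_ipk n z w =
    (\<Sum>p | p permutes {1..n}. 4 * double_series (\<lambda>i j. of_nat (C p i) * of_nat (C (inv p) j)))"
    unfolding P_pk_ipk_def sum_distrib_left by (intro sum.cong refl) simp
  also have "\<dots> = 4 * double_series (\<lambda>i j. \<Sum>p | p permutes {1..n}. of_nat (C p i) * of_nat (C (inv p) j))"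
    unfolding sum_distrib_left[symmetric] double_series_sum ..
  also have "(\<lambda>i j. \<Sum>p | p permutes {1..n}. of_nat (C p i) * of_nat (C (inv p) j)) =
    (\<lambda>i j. fps_nth (((1 + fps_X) / (1 - fps_X) :: rat fps) ^ (2 * i * j)) n)"
  proof (intro ext)
    fix i j
    have "(\<Sum>p | p permutes {1..n}. of_nat (C p i) * of_nat (C (inv p) j)) =
      (of_nat (card (tie_chains (\<lambda>_ v. odd v) n (4 * i * j))) :: rat)"
      unfolding C_def sum_card_tie_chains_inv[symmetric] by simp
    \<comment> \<open>The codes form \<open>2 * i * j\<close> couples of an even and an odd letter,
      each contributing (1 + x)/(1 - x).\<close>
    also have "4 * i * j = 2 * (2 * i * j)" by simp
    also have "of_nat (card (tie_chains (\<lambda>_ v. odd v) n (2 * (2 * i * j)))) =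
      fps_nth (((1 + fps_X) / (1 - fps_X) :: rat fps) ^ (2 * i * j)) n"
      unfolding fps_card_tie_chains_odd[symmetric] by simp
    finally show "(\<Sum>p | p permutes {1..n}. of_nat (C p i) * of_nat (C (inv p) j)) =
      fps_nth (((1 + fps_X) / (1 - fps_X) :: rat fps) ^ (2 * i * j)) n" .
  qed
  finally show ?thesis unfolding Q_def z_def w_def .
qed

lemma eulerian_var_t: "eulerian k var_t = fps_const (eulerian k (fps_X :: rat fps))"
proof -
  have "fps_const (sum f A) = (\<Sum>x\<in>A. fps_const (f x))" for f :: "(nat \<Rightarrow> nat) \<Rightarrow> rat fps" and A
    by (induction A rule: infinite_finite_induct) (simp_all flip: fps_const_add)
  then show ?thesis by (simp add: eulerian_def)
qed

lemma eulerian_quotient: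
  "(eulerian k var_s * eulerian k var_t) / ((1 - var_s) ^ (k + 1) * (1 - var_t) ^ (k + 1)) =
     double_series (\<lambda>i j. of_nat i ^ k * of_nat j ^ k)"
proof (rule fps_fps_divide_eqI)
  show "fps_nth (fps_nth ((1 - var_s) ^ (k + 1) * (1 - var_t) ^ (k + 1)) 0) 0 \<noteq> 0"
    by (simp add: fps_power_zeroth)
  have const: "fps_const ((1 - fps_X) ^ (k + 1) * F) = (1 - var_t) ^ (k + 1) * fps_const F"
    for F :: "rat fps"
    by (simp flip: fps_const_1_eq_1)
  have "Abs_fps (\<lambda>i. fps_const (of_nat i ^ k)) = (Abs_fps (\<lambda>i. of_nat i ^ k) :: rat fps fps)"
    by (simp add: fps_of_nat flip: fps_const_power)
  then show "double_series (\<lambda>i j. of_nat i ^ k * of_nat j ^ k) *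
      ((1 - var_s) ^ (k + 1) * (1 - var_t) ^ (k + 1)) = eulerian k var_s * eulerian k var_t"
    unfolding double_series_mult eulerian_var_t eulerian_fps_X const by (simp only: mult_ac)
qed

theorem theorem3p2:
  shows
    "(fps_const (1 / ((1 - var_s) * (1 - var_t))) +
      fps_const (1 / 4) *
        Abs_fps (\<lambda>n. if n = 0 then 0 else
          (((1 + var_s) * (1 + var_t)) / ((1 - var_s) * (1 - var_t))) ^ (n + 1) *
          P_pk_ipk n (4 * var_s / (1 + var_s)\<^sup>2) (4 * var_t / (1 + var_t)\<^sup>2))
      = double_series_x (\<lambda>i j. ((1 + fps_X) / (1 - fps_X)) ^ (2 * i * j)))
   \<and> (\<forall>n\<ge>1.
        (((1 + var_s) * (1 + var_t)) / ((1 - var_s) * (1 - var_t))) ^ (n + 1) *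
        P_pk_ipk n (4 * var_s / (1 + var_s)\<^sup>2) (4 * var_t / (1 + var_t)\<^sup>2)
      = 4 * double_series (\<lambda>i j. \<Sum>k=0..n.
          of_nat ((2 * i * j) choose k) * of_nat ((2 * i * j + n - k - 1) choose (n - k))))
   \<and> (\<forall>n\<ge>1.
        (((1 + var_s) * (1 + var_t)) / ((1 - var_s) * (1 - var_t))) ^ (n + 1) *
        P_pk_ipk n (4 * var_s / (1 + var_s)\<^sup>2) (4 * var_t / (1 + var_t)\<^sup>2)
      = 1 / fact n * (\<Sum>k=0..n. 4 ^ (k + 1) * of_nat (odd_cycle_count n k) *
          ((eulerian k var_s * eulerian k var_t) /
           ((1 - var_s) ^ (k + 1) * (1 - var_t) ^ (k + 1)))))"
proof (intro conjI allI impI)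
  let ?L = "\<lambda>n. (((1 + var_s) * (1 + var_t)) / ((1 - var_s) * (1 - var_t))) ^ (n + 1) *
    P_pk_ipk n (4 * var_s / (1 + var_s)\<^sup>2) (4 * var_t / (1 + var_t)\<^sup>2)"
  let ?f = "\<lambda>i j. ((1 + fps_X) / (1 - fps_X) :: rat fps) ^ (2 * i * j)"
  have quarter: "1 / 4 * (4 * g) = g" for g :: "rat fps fps"
    using fps_fps_divide_unit[of 4 1] by (simp flip: mult.assoc)
  \<comment> \<open>This is the coefficient of x to the power 0: each power of (1 + x)/(1 - x) has
    constant term 1.\<close>
  have const: "1 / ((1 - var_s) * (1 - var_t)) = double_series (\<lambda>i j. 1)"
  proof (rule fps_fps_divide_eqI)
    have "fps_const (1 - fps_X :: rat fps) * fps_const (Abs_fps (\<lambda>_. 1)) = 1"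
      unfolding fps_const_mult Abs_fps_1_times_one_minus_fps_X by simp
    then have "(1 - var_t) * fps_const (Abs_fps (\<lambda>_. 1)) = 1"
      by (simp only: fps_const_sub[symmetric] fps_const_1_eq_1)
    then have "double_series (\<lambda>i j. 1 * 1) * ((1 - var_s) * (1 - var_t)) =
      ((1 - var_s) * Abs_fps (\<lambda>_. 1)) * 1"
      unfolding double_series_mult fps_const_1_eq_1 by algebra
    then show "double_series (\<lambda>i j. 1) * ((1 - var_s) * (1 - var_t)) = 1"
      unfolding Abs_fps_1_times_one_minus_fps_X by simp
  qed simp
  show "fps_const (1 / ((1 - var_s) * (1 - var_t))) +
      fps_const (1 / 4) * Abs_fps (\<lambda>n. if n = 0 then 0 else ?L n) = double_series_x ?f"
  proof (rule fps_ext)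
    fix n
    show "fps_nth (fps_const (1 / ((1 - var_s) * (1 - var_t))) +
        fps_const (1 / 4) * Abs_fps (\<lambda>n. if n = 0 then 0 else ?L n)) n = fps_nth (double_series_x ?f) n"
    proof (cases "n = 0")
      case True
      then show ?thesis
        by (simp add: const double_series_x_def fps_nth_one_plus_X_over_one_minus_X_power_rec(1)
            del: div_add)
    next
      case False
      then have "?L n = 4 * double_series (\<lambda>i j. fps_nth (?f i j) n)"
        by (intro pk_ipk_series) simp
      then have "1 / 4 * ?L n = double_series (\<lambda>i j. fps_nth (?f i j) n)"
        using quarter by metis
      then show ?thesis using False unfolding double_series_x_def
        by (simp only: fps_add_nth fps_mult_left_const_nth fps_nth_Abs_fps fps_nth_fps_const if_False add_0_left)
    qed
  qed
  fix n :: nat assume n: "n \<ge> 1"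
  show "?L n = 4 * double_series (\<lambda>i j. \<Sum>k=0..n.
      of_nat ((2 * i * j) choose k) * of_nat ((2 * i * j + n - k - 1) choose (n - k)))"
    unfolding pk_ipk_series[OF n] fps_nth_one_plus_X_over_one_minus_X_power ..
  \<comment> \<open>The odd-cycle polynomial is evaluated at \<open>2 * (2 * i * j)\<close>. This
    accounts for the powers of 4: one factor stays outside, the others join the powers of
    \<open>i\<close> and \<open>j\<close>.\<close>
  have coeff: "(\<Sum>k=0..n. of_nat (4 ^ (k + 1) * odd_cycle_count n k) * (of_nat i ^ k * of_nat j ^ k)) =
    of_nat (fact n * 4) * fps_nth (?f i j) n" for i j
  proof -
    have "(\<Sum>k=0..n. of_nat (4 ^ (k + 1) * odd_cycle_count n k) * (of_nat i ^ k * of_nat j ^ k)) =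
      4 * (\<Sum>k=0..n. of_nat (odd_cycle_count n k) * of_nat (2 * (2 * i * j)) ^ k :: rat)"
      unfolding sum_distrib_left by (intro sum.cong refl) (simp add: power_mult_distrib mult_ac)
    also have "\<dots> = 4 * (fact n * fps_nth (?f i j) n)"
      unfolding sum_odd_cycle_count by (subst sum_odd_cycle_weight) simp_all
    finally show ?thesis by simp
  qed
  have "(\<Sum>k=0..n. 4 ^ (k + 1) * of_nat (odd_cycle_count n k) *
      ((eulerian k var_s * eulerian k var_t) / ((1 - var_s) ^ (k + 1) * (1 - var_t) ^ (k + 1)))) =
    (\<Sum>k=0..n. of_nat (4 ^ (k + 1) * odd_cycle_count n k) *
      double_series (\<lambda>i j. of_nat i ^ k * of_nat j ^ k))"
    unfolding eulerian_quotient by simp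
  also have "\<dots> = of_nat (fact n * 4) * double_series (\<lambda>i j. fps_nth (?f i j) n)"
    unfolding of_nat_mult_double_series double_series_sum coeff ..
  also have "\<dots> = ?L n * fact n"
    unfolding pk_ipk_series[OF n] by (simp add: mult_ac)
  finally have eq: "(\<Sum>k=0..n. 4 ^ (k + 1) * of_nat (odd_cycle_count n k) *
      ((eulerian k var_s * eulerian k var_t) / ((1 - var_s) ^ (k + 1) * (1 - var_t) ^ (k + 1)))) =
    ?L n * fact n" .
  have "(fact n :: rat fps fps) = of_nat (fact n)" by simp
  then have "fps_nth (fps_nth (fact n) 0) 0 \<noteq> (0 :: rat)"
    by (simp del: of_nat_fact)
  then have unit: "1 / fact n * fact n = (1 :: rat fps fps)" by (rule fps_fps_divide_unit)
  have cancel: "x = a * (x * b)" if "a * b = 1" for a b x :: "rat fps fps"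
    using that by (metis mult.left_commute mult_1_right)
  show "?L n = 1 / fact n * (\<Sum>k=0..n. 4 ^ (k + 1) * of_nat (odd_cycle_count n k) *
      ((eulerian k var_s * eulerian k var_t) / ((1 - var_s) ^ (k + 1) * (1 - var_t) ^ (k + 1))))"
    unfolding eq by (rule cancel[OF unit])
qed

end
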